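(* $\mathsf{WWKL}^\Delta\equiv_{sW}\mathsf{PC}_{2^\mathbb{N}}^\Delta\equiv_{sW}\mathsf{PC}_{\mathbb{R}}\equiv_{sW}\mathsf{PC}_{\mathbb{N}\times2^\mathbb{N}}$.
   Context: A represented space is a pair $(X,\delta_X)$ with $\delta_X:\subseteq\mathbb{N}^\mathbb{N}\to X$ a partial surjection; $\mathbb R$ carries its Cauchy representation. A realizer of $f:\subseteq X\rightrightarrows Y$ is a partial $F$ with $\delta_Y F(p)\in f(\delta_X(p))$ for all $p\in\mathrm{dom}(f\circ\delta_X)$. $f\le_{sW}g$ if there are computable partial $H,K:\subseteq\mathbb{N}^\mathbb{N}\to\mathbb{N}^\mathbb{N}$ such that $HGK$ realizes $f$ for every realizer $G$ of $g$; $\equiv_{sW}$ is the induced equivalence. $\mathcal{A}_-(X)$ denotes the closed subsets of $X$ represented by negative information (a name of $A$ enumerates basic open sets whose union is $X\setminus A$). For a Borel measure $\mu$ on $X$, $\mathsf{PC}_X:\subseteq\mathcal A_-(X)\rightrightarrows X$, $A\mapsto A$, is defined on closed $A$ with $\mu(A)>0$. Measures: $\mathbb N$ counting measure, $2^\mathbb N$ uniform product measure ($\mu(w2^\mathbb N)=2^{-|w|}$), $\mathbb R$ Lebesgue measure, $\mathbb N\times2^\mathbb N$ product measure. $\mathrm{Tr}$ is the set of binary trees $T\subseteq\{0,1\}^*$, represented by characteristic functions, $[T]$ its set of infinite paths; $\mathsf{WWKL}:\subseteq\mathrm{Tr}\rightrightarrows 2^\mathbb N$, $T\mapsto[T]$,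 has domain $\{T:\mu([T])>0\}$. Discrete jump: $\lim_\Delta:\subseteq\mathbb N^\mathbb N\to\mathbb N^\mathbb N$ maps $\langle p_0,p_1,\dots\rangle$ (where $\langle p_0,p_1,\dots\rangle\langle i,j\rangle=p_i(j)$) to $\lim_i p_i$, restricted to sequences $(p_i)$ that are eventually constant. The discrete jump $f^\Delta$ of $f:\subseteq(X,\delta_X)\rightrightarrows(Y,\delta_Y)$ is the same multi-valued function with input representation $\delta_X\circ\lim_\Delta$. *)

theory Defs
  imports "HOL-Probability.Probability" "HOL-Library.Nat_Bijection"
begin

datatype recf = Zr | Sc | Id nat | Cn recf "recf list" | Pr recf recf | Mn recf

inductive reval :: "recf \<Rightarrow> nat list \<Rightarrow> nat \<Rightarrow> bool" where
  zr: "reval Zr xs 0"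
| sc: "reval Sc (x # xs) (Suc x)"
| idp: "i < length xs \<Longrightarrow> reval (Id i) xs (xs ! i)"
| cn: "list_all2 (\<lambda>g y. reval g xs y) gs ys \<Longrightarrow> reval f ys z \<Longrightarrow> reval (Cn f gs) xs z"
| pr0: "reval f xs y \<Longrightarrow> reval (Pr f g) (0 # xs) y"
| prS: "reval (Pr f g) (n # xs) y \<Longrightarrow> reval g (n # y # xs) z \<Longrightarrow> reval (Pr f g) (Suc n # xs) z"
| mn: "reval f (n # xs) 0 \<Longrightarrow> (\<forall>m<n. \<exists>y. reval f (m # xs) y \<and> 0 < y) \<Longrightarrow> reval (Mn f) xs n"

definition total_computable :: "(nat \<Rightarrow> nat) \<Rightarrow> bool" where
  "total_computable g \<longleftrightarrow> (\<exists>r. \<forall>x. reval r [x] (g x))"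

type_synonym baire = "nat \<Rightarrow> nat"

text \<open>Code of the query "n-th output digit, given input prefix of length k".\<close>
definition query :: "nat \<Rightarrow> baire \<Rightarrow> nat \<Rightarrow> nat" where
  "query n p k = prod_encode (n, list_encode (map p [0..<k]))"

text \<open>Type-2 computability: F is computable iff a total recursive M, reading the
  prefix of the input, eventually outputs (value+1) for each output position and
  otherwise outputs 0 ("not yet"), on every input in the domain of F.\<close>
definition baire_computable :: "(baire \<Rightarrow> baire option) \<Rightarrow> bool" where
  "baire_computable F \<longleftrightarrow> (\<exists>M. total_computable M \<and>
     (\<forall>p q. F p = Some q \<longrightarrow>
        (\<forall>n. (\<exists>k. M (query n p k) = Suc (q n)) \<and>
             (\<forall>k. M (query n p k) = 0 \<or> M (query n p k) = Suc (q n)))))"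

definition pcomp :: "(baire \<Rightarrow> baire option) \<Rightarrow> (baire \<Rightarrow> baire option) \<Rightarrow> baire \<Rightarrow> baire option" where
  "pcomp G F p = Option.bind (F p) G"

text \<open>A representation is given as a relation "p is a name of x"; all the
  representations used below are single-valued partial surjections.
  A problem f :\<subseteq> X \<rightrightarrows> Y consists of input and output representation,
  its domain and its value relation.\<close>
record ('a, 'b) problem =
  inrep :: "baire \<Rightarrow> 'a \<Rightarrow> bool"
  outrep :: "baire \<Rightarrow> 'b \<Rightarrow> bool"
  pdom :: "'a set"
  prel :: "'a \<Rightarrow> 'b set"

definition realizes :: "(baire \<Rightarrow> baire option) \<Rightarrow> ('a, 'b) problem \<Rightarrow> bool" where
  "realizes F f \<longleftrightarrow> (\<forall>p x. inrep f p x \<and> x \<in> pdom f \<longrightarrow>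
      (\<exists>q. F p = Some q \<and> (\<exists>y. outrep f q y \<and> y \<in> prel f x)))"

definition sW_le :: "('a, 'b) problem \<Rightarrow> ('c, 'd) problem \<Rightarrow> bool" where
  "sW_le f g \<longleftrightarrow> (\<exists>H K. baire_computable H \<and> baire_computable K \<and>
      (\<forall>G. realizes G g \<longrightarrow> realizes (pcomp H (pcomp G K)) f))"

definition sW_equiv :: "('a, 'b) problem \<Rightarrow> ('c, 'd) problem \<Rightarrow> bool" where
  "sW_equiv f g \<longleftrightarrow> sW_le f g \<and> sW_le g f"

text \<open>Tupling: \<langle>p0,p1,...\<rangle>\<langle>i,j\<rangle> = p_i(j), with \<langle>i,j\<rangle> = prod_encode (i,j).
  lim_Delta p = q iff the sequence of components is eventually constant equal to q.\<close>
definition lim_Delta :: "baire \<Rightarrow> baire \<Rightarrow> bool" where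
  "lim_Delta p q \<longleftrightarrow> (\<exists>N. \<forall>i\<ge>N. (\<lambda>j. p (prod_encode (i, j))) = q)"

definition djump :: "('a, 'b) problem \<Rightarrow> ('a, 'b) problem" where
  "djump f = f\<lparr> inrep := (\<lambda>p x. \<exists>q. lim_Delta p q \<and> inrep f q x) \<rparr>"

text \<open>Bijective numbering of binary words.\<close>
fun bl_of_nat :: "nat \<Rightarrow> bool list" where
  "bl_of_nat n = (if n = 0 then [] else odd (n - 1) # bl_of_nat ((n - 1) div 2))"

declare bl_of_nat.simps[simp del]

definition cyl :: "bool list \<Rightarrow> (nat \<Rightarrow> bool) set" where
  "cyl w = {x. map x [0..<length w] = w}"

definition qnum :: "nat \<Rightarrow> real" where
  "qnum n = (case prod_decode n of (a, b) \<Rightarrow> real_of_int (int_decode a) / real (b + 1))"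

definition ival :: "nat \<Rightarrow> real set" where
  "ival n = (case prod_decode n of (a, b) \<Rightarrow> {qnum a <..< qnum b})"

definition rep_nat :: "baire \<Rightarrow> nat \<Rightarrow> bool" where
  "rep_nat p n \<longleftrightarrow> p 0 = n"

definition rep_cantor :: "baire \<Rightarrow> (nat \<Rightarrow> bool) \<Rightarrow> bool" where
  "rep_cantor p x \<longleftrightarrow> (\<forall>n. p n = of_bool (x n))"

definition rep_real :: "baire \<Rightarrow> real \<Rightarrow> bool" where
  "rep_real p x \<longleftrightarrow> (\<forall>n. \<bar>qnum (p n) - x\<bar> \<le> (1/2) ^ n)"

definition rep_natcantor :: "baire \<Rightarrow> nat \<times> (nat \<Rightarrow> bool) \<Rightarrow> bool" where
  "rep_natcantor p z \<longleftrightarrow> p 0 = fst z \<and> (\<forall>n. p (Suc n) = of_bool (snd z n))"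

definition bas_nat :: "nat \<Rightarrow> nat set" where "bas_nat n = {n}"
definition bas_cantor :: "nat \<Rightarrow> (nat \<Rightarrow> bool) set" where "bas_cantor n = cyl (bl_of_nat n)"
definition bas_real :: "nat \<Rightarrow> real set" where "bas_real n = ival n"
definition bas_natcantor :: "nat \<Rightarrow> (nat \<times> (nat \<Rightarrow> bool)) set" where
  "bas_natcantor n = (case prod_decode n of (a, b) \<Rightarrow> {a} \<times> cyl (bl_of_nat b))"

text \<open>Negative information: p enumerates (p i = k+1 lists basic set k, p i = 0 lists
  nothing) basic open sets whose union is the complement of A.\<close>
definition rep_neg :: "(nat \<Rightarrow> 'a set) \<Rightarrow> baire \<Rightarrow> 'a set \<Rightarrow> bool" where
  "rep_neg bas p A \<longleftrightarrow> A = - (\<Union>i\<in>{i. 0 < p i}. bas (p i - 1))"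

definition cantor_measure :: "(nat \<Rightarrow> bool) measure" where
  "cantor_measure = PiM UNIV (\<lambda>_. measure_pmf (bernoulli_pmf (1/2)))"

definition natcantor_measure :: "(nat \<times> (nat \<Rightarrow> bool)) measure" where
  "natcantor_measure = count_space UNIV \<Otimes>\<^sub>M cantor_measure"

definition PC :: "(nat \<Rightarrow> 'a set) \<Rightarrow> (baire \<Rightarrow> 'a \<Rightarrow> bool) \<Rightarrow> 'a measure \<Rightarrow> ('a set, 'a) problem" where
  "PC bas rep M = \<lparr> inrep = rep_neg bas, outrep = rep, pdom = {A. 0 < emeasure M A}, prel = (\<lambda>A. A) \<rparr>"

definition PC_cantor :: "((nat \<Rightarrow> bool) set, nat \<Rightarrow> bool) problem" where
  "PC_cantor = PC bas_cantor rep_cantor cantor_measure"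

definition PC_real :: "(real set, real) problem" where
  "PC_real = PC bas_real rep_real lborel"

definition PC_natcantor :: "((nat \<times> (nat \<Rightarrow> bool)) set, nat \<times> (nat \<Rightarrow> bool)) problem" where
  "PC_natcantor = PC bas_natcantor rep_natcantor natcantor_measure"

definition is_tree :: "bool list set \<Rightarrow> bool" where
  "is_tree T \<longleftrightarrow> (\<forall>u v. u @ v \<in> T \<longrightarrow> u \<in> T)"

definition paths :: "bool list set \<Rightarrow> (nat \<Rightarrow> bool) set" where
  "paths T = {x. \<forall>n. map x [0..<n] \<in> T}"

definition rep_tree :: "baire \<Rightarrow> bool list set \<Rightarrow> bool" where
  "rep_tree p T \<longleftrightarrow> is_tree T \<and> (\<forall>n. p n = of_bool (bl_of_nat n \<in> T))"

definition WWKL :: "(bool list set, nat \<Rightarrow> bool) problem" where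
  "WWKL = \<lparr> inrep = rep_tree, outrep = rep_cantor,
            pdom = {T. 0 < emeasure cantor_measure (paths T)}, prel = paths \<rparr>"

end

theory Submission
  imports Defs
begin

text \<open>
  All problems are reduced along the cycle
  \<open>PC\<^sub>\<real> \<le> PC\<^sub>N\<^sub>\<times>\<^sub>C \<le> WWKL\<^sup>\<Delta> \<le> PC\<^sub>C\<^sup>\<Delta> \<le> PC\<^sub>N\<^sub>\<times>\<^sub>C \<le> PC\<^sub>\<real>\<close>, where \<open>N \<times> C\<close> stands for \<open>\<nat> \<times> 2\<^sup>\<nat>\<close>.

  For \<open>PC\<^sub>N\<^sub>\<times>\<^sub>C \<le> WWKL\<^sup>\<Delta>\<close>, the claim ``column \<open>n\<close> has measure at least \<open>2\<^sup>-\<^sup>k\<close>'' is refutable from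
  negative information, so the least claim not refuted so far changes only finitely often; the
  column \<open>n\<close> found in the limit is remembered in the path itself by the prefix \<open>0\<^sup>n1\<close>. Conversely, for
  \<open>PC\<^sub>C\<^sup>\<Delta> \<le> PC\<^sub>N\<^sub>\<times>\<^sub>C\<close> column \<open>m\<close> bets that the given sequence of names is constant from index \<open>m\<close> on,
  and it is emptied as soon as this turns out to be wrong.

  Between \<open>\<real>\<close> and \<open>N \<times> C\<close> one passes by binary expansion, which carries the uniform measure to
  Lebesgue measure. To decode binary digits from a Cauchy name, a neighbourhood of every rational
  number is removed from the closed set; these neighbourhoods have finite total measure. Since infinitely
  many unit intervals hold copies of each column, in some of these copies less is removed than the column's
  positive measure.
\<close>

section \<open>Computable functions on the natural numbers\<close>

text \<open>The outer machine of a strong reduction sees the answer alone, so all data for decoding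
  must be readable there. For this reason the copies of column \<open>n\<close> on the line sit at
  the integers \<open>prod_encode (n, e)\<close>: the integer part of a solution reveals its column.
  Positivity of a measure can be neither confirmed nor refuted in finite time. With a threshold it
  becomes refutable, because the levels of a tree have measures that decrease to that of its paths,
  and each of them is found by counting words. Binary digits cannot be settled from approximations
  at dyadic rationals. Deleting just these points would in general not leave a closed set, as they
  are dense; open neighbourhoods have to go, at the price of positive measure. Evaluating an
  expansion is computable everywhere, so the passage from reals to columns needs no such loss: each
  integer unit interval is pulled back to one column. Unbounded search is delegated to the growing
  input prefix, so that the machines written here need only primitive recursion and bounded
  search.\<close>

definition recursive_on :: "nat \<Rightarrow> (nat list \<Rightarrow> nat) \<Rightarrow> bool" where
  "recursive_on k f \<longleftrightarrow> (\<exists>r. \<forall>xs. length xs = k \<longrightarrow> reval r xs (f xs))"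

named_theorems rc_intros
named_theorems tc_intros

lemma recursive_on_nth [rc_intros]: "i < k \<Longrightarrow> recursive_on k (\<lambda>xs. xs ! i)"
  unfolding recursive_on_def by (metis reval.idp)

lemma recursive_on_Cn:
  assumes "recursive_on (length gs) f" "\<And>g. g \<in> set gs \<Longrightarrow> recursive_on k g"
  shows "recursive_on k (\<lambda>xs. f (map (\<lambda>g. g xs) gs))"
proof -
  obtain r where r: "\<And>xs. length xs = length gs \<Longrightarrow> reval r xs (f xs)"
    using assms(1) unfolding recursive_on_def by blast
  have "\<exists>s. \<forall>g\<in>set gs. \<forall>xs. length xs = k \<longrightarrow> reval (s g) xs (g xs)"
    using assms(2) unfolding recursive_on_def by (intro bchoice) blast
  then obtain s where s: "\<And>g xs. g \<in> set gs \<Longrightarrow> length xs = k \<Longrightarrow> reval (s g) xs (g xs)"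
    by blast
  have "reval (Cn r (map s gs)) xs (f (map (\<lambda>g. g xs) gs))" if "length xs = k" for xs
  proof (rule reval.cn)
    show "list_all2 (\<lambda>g y. reval g xs y) (map s gs) (map (\<lambda>g. g xs) gs)"
      using s that by (simp add: list_all2_map1 list_all2_map2 list_all2_same)
  qed (simp add: r)
  then show ?thesis unfolding recursive_on_def by blast
qed

lemma recursive_on_comp1:
  assumes "recursive_on 1 (\<lambda>xs. g (xs ! 0))" "recursive_on k f"
  shows "recursive_on k (\<lambda>xs. g (f xs))"
  using recursive_on_Cn[of "[f]" "\<lambda>xs. g (xs ! 0)" k] assms by simp

lemma recursive_on_comp2:
  assumes "recursive_on 2 (\<lambda>xs. h (xs ! 0) (xs ! 1))" "recursive_on k f" "recursive_on k g"
  shows "recursive_on k (\<lambda>xs. h (f xs) (g xs))"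
  using recursive_on_Cn[of "[f, g]" "\<lambda>xs. h (xs ! 0) (xs ! 1)" k] assms
  by (auto simp: numeral_2_eq_2)

lemma recursive_on_Suc [rc_intros]:
  assumes "recursive_on k f"
  shows "recursive_on k (\<lambda>xs. Suc (f xs))"
proof (rule recursive_on_comp1[OF _ assms])
  have "reval Sc xs (Suc (xs ! 0))" if "length xs = 1" for xs
    using that by (cases xs) (auto intro: reval.sc)
  then show "recursive_on 1 (\<lambda>xs. Suc (xs ! 0))"
    unfolding recursive_on_def by blast
qed

lemma recursive_on_const [rc_intros]: "recursive_on k (\<lambda>xs. c)"
proof (induction c)
  case 0
  show ?case unfolding recursive_on_def by (blast intro: reval.zr)
qed (rule recursive_on_Suc)

lemma recursive_on_rec:
  assumes "recursive_on k n" "recursive_on k a" "recursive_on (Suc (Suc k)) b"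
    and b': "\<And>xs i r. length xs = k \<Longrightarrow> b (i # r # xs) = b' xs i r"
  shows "recursive_on k (\<lambda>xs. rec_nat (a xs) (b' xs) (n xs))"
proof -
  obtain ra rb where ra: "\<And>xs. length xs = k \<Longrightarrow> reval ra xs (a xs)"
    and rb: "\<And>xs. length xs = Suc (Suc k) \<Longrightarrow> reval rb xs (b xs)"
    using assms unfolding recursive_on_def by blast
  have Pr: "reval (Pr ra rb) (m # xs) (rec_nat (a xs) (b' xs) m)" if "length xs = k" for m xs
  proof (induction m)
    case (Suc m)
    have "reval rb (m # rec_nat (a xs) (b' xs) m # xs) (b' xs m (rec_nat (a xs) (b' xs) m))"
      using rb[of "m # rec_nat (a xs) (b' xs) m # xs"] b' that by simp
    then show ?case using Suc by (auto intro: reval.prS)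
  qed (auto intro: reval.pr0 ra that)
  let ?F = "\<lambda>ys. rec_nat (a (tl ys)) (b' (tl ys)) (hd ys)"
  have "recursive_on (Suc k) ?F"
    unfolding recursive_on_def
  proof (intro exI allI impI)
    show "reval (Pr ra rb) ys (?F ys)" if "length ys = Suc k" for ys
      using that Pr by (cases ys) auto
  qed
  \<comment> \<open>\<open>Pr\<close> recurses on the head of its argument list. Composition with
    \<open>n\<close> followed by all \<open>k\<close> projections supplies the bound and hands on
    the original arguments.\<close>
  then have "recursive_on k (\<lambda>xs. ?F (map (\<lambda>g. g xs) (n # map (\<lambda>i xs. xs ! i) [0..<k])))"
    by (intro recursive_on_Cn) (auto intro: assms rc_intros)
  moreover have "?F (map (\<lambda>g. g xs) (n # map (\<lambda>i xs. xs ! i) [0..<k])) = rec_nat (a xs) (b' xs) (n xs)"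
    if "length xs = k" for xs
    by (simp add: comp_def map_nth flip: that)
  ultimately show ?thesis
    unfolding recursive_on_def by auto
qed

lemma recursive_on_add [rc_intros]:
  assumes "recursive_on k f" "recursive_on k g"
  shows "recursive_on k (\<lambda>xs. f xs + g xs)"
proof (rule recursive_on_comp2[OF _ assms])
  have "recursive_on 2 (\<lambda>xs. rec_nat (xs ! 1) (\<lambda>i r. Suc r) (xs ! 0))"
    by (rule recursive_on_rec[where b = "\<lambda>ys. Suc (ys ! 1)"]) (intro rc_intros | simp)+
  moreover have "rec_nat y (\<lambda>i r. Suc r) x = x + y" for x y :: nat
    by (induction x) auto
  ultimately show "recursive_on 2 (\<lambda>xs. xs ! 0 + xs ! 1)" by simp
qed

lemma recursive_on_diff [rc_intros]:
  assumes "recursive_on k f" "recursive_on k g"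
  shows "recursive_on k (\<lambda>xs. f xs - g xs)"
proof (rule recursive_on_comp2[OF _ assms])
  have "recursive_on 1 (\<lambda>xs. rec_nat 0 (\<lambda>i r. i) (xs ! 0))"
    by (rule recursive_on_rec[where b = "\<lambda>ys. ys ! 0"]) (intro rc_intros | simp)+
  moreover have "rec_nat 0 (\<lambda>i r. i) x = x - 1" for x :: nat
    by (cases x) auto
  ultimately have pred: "recursive_on 1 (\<lambda>xs. xs ! 0 - 1)" by simp
  have "recursive_on 2 (\<lambda>xs. rec_nat (xs ! 0) (\<lambda>i r. r - 1) (xs ! 1))"
    by (rule recursive_on_rec[where b = "\<lambda>ys. ys ! 1 - 1"])
       (intro rc_intros recursive_on_comp1[OF pred] | simp)+
  moreover have "rec_nat x (\<lambda>i r. r - 1) y = x - y" for x y :: nat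
    by (induction y) auto
  ultimately show "recursive_on 2 (\<lambda>xs. xs ! 0 - xs ! 1)" by simp
qed

lemma recursive_on_triangle [rc_intros]:
  assumes "recursive_on k f"
  shows "recursive_on k (\<lambda>xs. triangle (f xs))"
proof (rule recursive_on_comp1[OF _ assms])
  have "recursive_on 1 (\<lambda>xs. rec_nat 0 (\<lambda>i r. r + Suc i) (xs ! 0))"
    by (rule recursive_on_rec[where b = "\<lambda>ys. ys ! 1 + Suc (ys ! 0)"]) (intro rc_intros | simp)+
  moreover have "rec_nat 0 (\<lambda>i r. r + Suc i) n = triangle n" for n
    by (induction n) auto
  ultimately show "recursive_on 1 (\<lambda>xs. triangle (xs ! 0))" by simp
qed

lemma recursive_on_prod_encode [rc_intros]:
  assumes "recursive_on k f" "recursive_on k g"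
  shows "recursive_on k (\<lambda>xs. prod_encode (f xs, g xs))"
  using assms unfolding prod_encode_def by (auto intro!: rc_intros)

abbreviation \<pi>1 :: "nat \<Rightarrow> nat" where "\<pi>1 z \<equiv> fst (prod_decode z)"
abbreviation \<pi>2 :: "nat \<Rightarrow> nat" where "\<pi>2 z \<equiv> snd (prod_decode z)"

lemma mono_triangle: "m \<le> n \<Longrightarrow> triangle m \<le> triangle n"
  by (induction rule: dec_induct) auto

text \<open>The diagonal \<open>a + b\<close> of the coded pair is the largest \<open>s\<close> with
  \<open>triangle s \<le> z\<close>. By truncated subtraction the summand is 1 exactly when
  \<open>triangle (Suc i) \<le> z\<close>, so the recursion counts up to this diagonal;
  \<open>z\<close> rounds suffice since \<open>a + b \<le> z\<close>.\<close>

lemma prod_decode_root: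
  fixes z :: nat
  defines "s \<equiv> rec_nat 0 (\<lambda>i r. r + (1 - (triangle (Suc i) - z))) z"
  shows "\<pi>1 z = z - triangle s" "\<pi>2 z = s - (z - triangle s)"
proof -
  obtain a b where ab: "prod_decode z = (a, b)" by (cases "prod_decode z")
  then have z: "z = triangle (a + b) + a"
    using prod_decode_inverse[of z] by (simp add: prod_encode_def)
  have le: "a + b \<le> z"
  proof -
    have "n \<le> triangle n" for n by (induction n) auto
    then show ?thesis unfolding z by (meson le_add1 le_trans)
  qed
  have "rec_nat 0 (\<lambda>i r. r + (1 - (triangle (Suc i) - z))) m = min m (a + b)" for m
  proof (induction m)
    case (Suc m)
    show ?case
    proof (cases "m < a + b")
      case True
      then have "triangle (Suc m) \<le> z"
        using mono_triangle[of "Suc m" "a + b"] unfolding z by simp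
      then show ?thesis using Suc True by simp
    next
      case False
      then have "triangle (Suc (a + b)) \<le> triangle (Suc m)"
        by (intro mono_triangle) simp
      then have "z < triangle (Suc m)" unfolding z by simp
      then show ?thesis using Suc False by (simp del: triangle_Suc)
    qed
  qed simp
  then have "s = a + b" unfolding s_def using le by simp
  then show "\<pi>1 z = z - triangle s" "\<pi>2 z = s - (z - triangle s)"
    using ab z by simp_all
qed

lemma recursive_on_decode:
  assumes "recursive_on k f"
  shows recursive_on_fst_decode [rc_intros]: "recursive_on k (\<lambda>xs. \<pi>1 (f xs))"
    and recursive_on_snd_decode [rc_intros]: "recursive_on k (\<lambda>xs. \<pi>2 (f xs))"
proof -
  let ?s = "\<lambda>z. rec_nat 0 (\<lambda>i r. r + (1 - (triangle (Suc i) - z))) z"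
  have s: "recursive_on 1 (\<lambda>xs. ?s (xs ! 0))"
    by (rule recursive_on_rec[where b = "\<lambda>ys. ys ! 1 + (1 - (triangle (Suc (ys ! 0)) - ys ! 2))"])
       (intro rc_intros | simp)+
  have "recursive_on 1 (\<lambda>xs. xs ! 0 - triangle (?s (xs ! 0)))"
    "recursive_on 1 (\<lambda>xs. ?s (xs ! 0) - (xs ! 0 - triangle (?s (xs ! 0))))"
    by (intro rc_intros s; simp)+
  then have "recursive_on 1 (\<lambda>xs. \<pi>1 (xs ! 0))" "recursive_on 1 (\<lambda>xs. \<pi>2 (xs ! 0))"
    unfolding prod_decode_root .
  then show "recursive_on k (\<lambda>xs. \<pi>1 (f xs))" "recursive_on k (\<lambda>xs. \<pi>2 (f xs))"
    using assms by (auto intro: recursive_on_comp1)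
qed

section \<open>Unary computable functions and decidable predicates, with syntax-directed
  rules\<close>

lemma total_computable_iff: "total_computable f \<longleftrightarrow> recursive_on 1 (\<lambda>xs. f (xs ! 0))"
proof -
  have "(\<forall>x. reval r [x] (f x)) \<longleftrightarrow> (\<forall>xs. length xs = 1 \<longrightarrow> reval r xs (f (xs ! 0)))" for r
    by (auto simp: length_Suc_conv)
  then show ?thesis unfolding total_computable_def recursive_on_def by simp
qed

lemma tc_const [tc_intros]: "total_computable (\<lambda>x. c)"
  and tc_id [tc_intros]: "total_computable (\<lambda>x. x)"
  unfolding total_computable_iff by (auto intro!: rc_intros)

lemma tc_comp: "total_computable g \<Longrightarrow> total_computable f \<Longrightarrow> total_computable (\<lambda>x. g (f x))"
  unfolding total_computable_iff by (rule recursive_on_comp1)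

lemma tc_basic [tc_intros]:
  assumes "total_computable f"
  shows "total_computable (\<lambda>x. Suc (f x))" "total_computable (\<lambda>x. \<pi>1 (f x))"
    "total_computable (\<lambda>x. \<pi>2 (f x))"
  using assms unfolding total_computable_iff by (auto intro!: rc_intros)

lemma tc_basic2 [tc_intros]:
  assumes "total_computable f" "total_computable g"
  shows "total_computable (\<lambda>x. f x + g x)" "total_computable (\<lambda>x. f x - g x)"
    "total_computable (\<lambda>x. prod_encode (f x, g x))"
  using assms unfolding total_computable_iff by (auto intro!: rc_intros)

text \<open>The rules speak about unary functions only, so the parameter, the loop index and the
  previous value are packed into one number \<open>z\<close>. The later rules with bound variables
  have premises of the same kind.\<close>

lemma tc_rec [tc_intros]:
  assumes "total_computable a" "total_computable (\<lambda>z. b (\<pi>1 z) (\<pi>1 (\<pi>2 z)) (\<pi>2 (\<pi>2 z)))"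
    "total_computable n"
  shows "total_computable (\<lambda>x. rec_nat (a x) (b x) (n x))"
  unfolding total_computable_iff
proof (rule recursive_on_rec)
  let ?b = "\<lambda>ys. (\<lambda>z. b (\<pi>1 z) (\<pi>1 (\<pi>2 z)) (\<pi>2 (\<pi>2 z))) (prod_encode (ys ! 2, prod_encode (ys ! 0, ys ! 1)))"
  show "recursive_on (Suc (Suc 1)) ?b"
    by (rule recursive_on_comp1[OF assms(2)[unfolded total_computable_iff]]) (intro rc_intros; simp)
  show "?b (i # r # xs) = b (xs ! 0) i r" for xs i r by simp
qed (use assms in \<open>simp_all add: total_computable_iff\<close>)

lemma tc_mult [tc_intros]:
  assumes "total_computable f" "total_computable g"
  shows "total_computable (\<lambda>x. f x * g x)"
proof -
  have "total_computable (\<lambda>x. rec_nat 0 (\<lambda>i r. r + g x) (f x))"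
    by (intro tc_intros assms tc_comp[OF assms(2)])
  moreover have "rec_nat 0 (\<lambda>i r. r + m) n = n * m" for n m :: nat
    by (induction n) auto
  ultimately show ?thesis by simp
qed

lemma tc_power [tc_intros]:
  fixes f :: "nat \<Rightarrow> nat"
  assumes "total_computable f" "total_computable g"
  shows "total_computable (\<lambda>x. f x ^ g x)"
proof -
  have "total_computable (\<lambda>x. rec_nat 1 (\<lambda>i r. f x * r) (g x))"
    by (intro tc_intros assms tc_comp[OF assms(1)])
  moreover have "rec_nat 1 (\<lambda>i r. m * r) n = m ^ n" for n m :: nat
    by (induction n) auto
  ultimately show ?thesis by simp
qed

lemma tc_sum [tc_intros]:
  fixes f :: "nat \<Rightarrow> nat \<Rightarrow> nat"
  assumes "total_computable n" "total_computable (\<lambda>z. f (\<pi>1 z) (\<pi>2 z))"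
  shows "total_computable (\<lambda>x. \<Sum>i<n x. f x i)"
proof -
  have f: "total_computable (\<lambda>z. f (a z) (b z))" if "total_computable a" "total_computable b" for a b
    using tc_comp[OF assms(2) tc_basic2(3)[OF that]] by simp
  have "total_computable (\<lambda>x. rec_nat 0 (\<lambda>i r. r + f x i) (n x))"
    by (intro tc_intros f assms)
  moreover have "rec_nat 0 (\<lambda>i r. r + f x i) m = (\<Sum>i<m. f x i)" for x m
    by (induction m) auto
  ultimately show ?thesis by simp
qed

abbreviation tcb :: "(nat \<Rightarrow> bool) \<Rightarrow> bool" where
  "tcb P \<equiv> total_computable (\<lambda>x. of_bool (P x))"

lemma tcb_le [tc_intros]:
  fixes f g :: "nat \<Rightarrow> nat"
  assumes "total_computable f" "total_computable g"
  shows "tcb (\<lambda>x. f x \<le> g x)"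
proof -
  have "total_computable (\<lambda>x. 1 - (f x - g x))" by (intro tc_intros assms)
  moreover have "1 - (a - b) = of_bool (a \<le> b)" for a b :: nat by simp
  ultimately show ?thesis by simp
qed

lemma tcb_eq_0:
  fixes f :: "nat \<Rightarrow> nat"
  assumes "total_computable f"
  shows "tcb (\<lambda>x. f x = 0)"
  using tcb_le[OF assms tc_const[of 0]] by simp

lemma tcb_not [tc_intros]: "tcb P \<Longrightarrow> tcb (\<lambda>x. \<not> P x)"
  using tcb_eq_0[of "\<lambda>x. of_bool (P x)"] by simp

lemma tcb_conj [tc_intros]: "tcb P \<Longrightarrow> tcb Q \<Longrightarrow> tcb (\<lambda>x. P x \<and> Q x)"
  using tc_mult[of "\<lambda>x. of_bool (P x)" "\<lambda>x. of_bool (Q x)"] by (simp add: of_bool_conj)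

lemma tcb_disj [tc_intros]: "tcb P \<Longrightarrow> tcb Q \<Longrightarrow> tcb (\<lambda>x. P x \<or> Q x)"
  using tcb_not[OF tcb_conj[OF tcb_not tcb_not, of P Q]] by simp

lemma tcb_imp [tc_intros]: "tcb P \<Longrightarrow> tcb Q \<Longrightarrow> tcb (\<lambda>x. P x \<longrightarrow> Q x)"
  using tcb_disj[OF tcb_not, of P Q] by (simp only: imp_conv_disj)

lemma tcb_less [tc_intros]:
  fixes f g :: "nat \<Rightarrow> nat"
  shows "total_computable f \<Longrightarrow> total_computable g \<Longrightarrow> tcb (\<lambda>x. f x < g x)"
  using tcb_le[OF tc_basic(1), of f g] by (simp add: Suc_le_eq)

lemma tcb_eq [tc_intros]:
  fixes f g :: "nat \<Rightarrow> nat"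
  shows "total_computable f \<Longrightarrow> total_computable g \<Longrightarrow> tcb (\<lambda>x. f x = g x)"
  using tcb_conj[OF tcb_le tcb_le, of f g g f] by (simp add: eq_iff)

lemma tcb_eq_bool [tc_intros]: "tcb P \<Longrightarrow> tcb Q \<Longrightarrow> tcb (\<lambda>x. P x = Q x)"
  using tcb_eq[of "\<lambda>x. of_bool (P x)" "\<lambda>x. of_bool (Q x)"] by (simp add: of_bool_eq_iff)

lemma tc_if [tc_intros]:
  fixes f g :: "nat \<Rightarrow> nat"
  assumes "tcb P" "total_computable f" "total_computable g"
  shows "total_computable (\<lambda>x. if P x then f x else g x)"
proof -
  have "total_computable (\<lambda>x. of_bool (P x) * f x + of_bool (\<not> P x) * g x)"
    by (intro tc_intros assms)
  moreover have "of_bool b * m + of_bool (\<not> b) * n = (if b then m else n)" for b and m n :: nat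
    by simp
  ultimately show ?thesis by simp
qed

lemma tcb_all [tc_intros]:
  fixes n :: "nat \<Rightarrow> nat"
  assumes "total_computable n" "tcb (\<lambda>z. P (\<pi>1 z) (\<pi>2 z))"
  shows "tcb (\<lambda>x. \<forall>i<n x. P x i)"
proof -
  have "tcb (\<lambda>x. (\<Sum>i<n x. of_bool (\<not> P x i)) = (0 :: nat))"
    by (intro tc_intros assms)
  moreover have "(\<Sum>i<m. of_bool (\<not> P x i)) = (0 :: nat) \<longleftrightarrow> (\<forall>i<m. P x i)" for x m
    by (subst sum_eq_0_iff) auto
  ultimately show ?thesis by simp
qed

lemma tcb_ex [tc_intros]:
  fixes n :: "nat \<Rightarrow> nat"
  assumes "total_computable n" "tcb (\<lambda>z. P (\<pi>1 z) (\<pi>2 z))"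
  shows "tcb (\<lambda>x. \<exists>i<n x. P x i)"
  using tcb_not[OF tcb_all[OF assms(1) tcb_not, of P]] assms(2) by simp

text \<open>The disjunct \<open>i = n x\<close> bounds the search and is its default value when
  nothing is found. The result equals the number of \<open>i\<close> below the bound such that no
  witness occurs up to \<open>i\<close>, which is a bounded sum.\<close>

lemma tc_Least [tc_intros]:
  assumes "total_computable n" "tcb (\<lambda>z. P (\<pi>1 z) (\<pi>2 z))"
  shows "total_computable (\<lambda>x. LEAST i. i = n x \<or> P x i)"
proof -
  have P: "tcb (\<lambda>z. P (a z) (b z))" if "total_computable a" "total_computable b" for a b
    using tc_comp[OF assms(2) tc_basic2(3)[OF that]] by simp
  have "total_computable (\<lambda>x. \<Sum>i<n x. of_bool (\<forall>j<Suc i. \<not> P x j))"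
    by (intro tc_intros P assms)
  moreover have "(\<Sum>i<m. of_bool (\<forall>j<Suc i. \<not> P x j)) = (LEAST i. i = m \<or> P x i)" for x m
  proof -
    let ?l = "LEAST i. i = m \<or> P x i"
    have l: "?l = m \<or> P x ?l" by (rule LeastI[of _ m]) simp
    have le: "?l \<le> m" by (rule Least_le) simp
    have min: "\<not> P x j" if "j < ?l" for j using not_less_Least[OF that] by simp
    have "(\<forall>j<Suc i. \<not> P x j) \<longleftrightarrow> i < ?l" if "i < m" for i
    proof
      assume "\<forall>j<Suc i. \<not> P x j"
      then have "\<not> ?l \<le> i" using l that by (auto simp: less_Suc_eq_le)
      then show "i < ?l" by simp
    next
      assume "i < ?l"
      then show "\<forall>j<Suc i. \<not> P x j" using min by (meson le_less_trans less_Suc_eq_le)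
    qed
    then have "(\<Sum>i<m. of_bool (\<forall>j<Suc i. \<not> P x j)) = (\<Sum>i<m. of_bool (i < ?l))"
      by (intro sum.cong) auto
    also have "\<dots> = (\<Sum>i\<in>{..<m} \<inter> {i. i < ?l}. 1)"
      by (subst sum.inter_restrict) (auto intro!: sum.cong)
    also have "{..<m} \<inter> {i. i < ?l} = {..<?l}" using le by auto
    also have "(\<Sum>i<?l. 1) = ?l" by simp
    finally show ?thesis .
  qed
  ultimately show ?thesis by simp
qed

lemma tc_div [tc_intros]:
  assumes "total_computable f" "total_computable g"
  shows "total_computable (\<lambda>x. f x div g x)"
proof -
  \<comment> \<open>For divisor 0 the search would end at its default \<open>f x\<close>, whereas
    \<open>div\<close> gives 0.\<close>
  have "total_computable (\<lambda>x. if g x = 0 then 0 else LEAST i. i = f x \<or> f x < Suc i * g x)"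
    by (intro tc_intros assms tc_comp[OF assms(1)] tc_comp[OF assms(2)])
  moreover have "(LEAST i. i = m \<or> m < Suc i * n) = m div n" if "n \<noteq> 0" for m n :: nat
  proof (rule Least_equality)
    show "m div n = m \<or> m < Suc (m div n) * n"
      using that by (simp add: dividend_less_div_times)
    show "m div n \<le> i" if "i = m \<or> m < Suc i * n" for i
      using that less_mult_imp_div_less[of m "Suc i" n] by auto
  qed
  then have "(\<lambda>x. if g x = 0 then 0 else LEAST i. i = f x \<or> f x < Suc i * g x) = (\<lambda>x. f x div g x)"
    by auto
  ultimately show ?thesis by simp
qed

lemma tc_mod [tc_intros]:
  fixes f g :: "nat \<Rightarrow> nat"
  assumes "total_computable f" "total_computable g"
  shows "total_computable (\<lambda>x. f x mod g x)"
  unfolding modulo_nat_def by (intro tc_intros assms)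

lemma tcb_odd [tc_intros]: "total_computable f \<Longrightarrow> tcb (\<lambda>x. odd (f x))"
  using tcb_eq[OF tc_mod[OF _ tc_const] tc_const, of f 2 1] by (simp add: odd_iff_mod_2_eq_one)

section \<open>Codes of lists and words\<close>

text \<open>A nonempty list is coded as the successor of the pair of head and coded tail, so
  \<open>\<pi>2 (r - 1)\<close> is the tail. The code 0 of the empty list is a fixed point, because
  \<open>0 - 1 = 0\<close> and 0 decodes to \<open>(0, 0)\<close>.\<close>

definition code_drop :: "nat \<Rightarrow> nat \<Rightarrow> nat" where
  "code_drop l n = rec_nat l (\<lambda>i r. \<pi>2 (r - 1)) n"

definition code_nth :: "nat \<Rightarrow> nat \<Rightarrow> nat" where
  "code_nth l n = \<pi>1 (code_drop l n - 1)"

definition code_length :: "nat \<Rightarrow> nat" where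
  "code_length l = (LEAST n. n = l \<or> code_drop l n = 0)"

lemma prod_decode_0 [simp]: "prod_decode 0 = (0, 0)"
  using prod_encode_inverse[of "(0, 0)"] by (simp add: prod_encode_def)

lemma code_drop_eq: "code_drop (list_encode xs) n = list_encode (drop n xs)"
proof (induction n)
  case (Suc n)
  then show ?case
    by (cases "drop n xs") (auto simp: code_drop_def drop_Suc simp flip: tl_drop)
qed (simp add: code_drop_def)

lemma list_encode_eq_0_iff: "list_encode xs = 0 \<longleftrightarrow> xs = []"
  by (cases xs) auto

lemma code_nth_eq: "code_nth (list_encode xs) n = (if n < length xs then xs ! n else 0)"
  unfolding code_nth_def code_drop_eq by (cases "drop n xs") (auto simp: drop_eq_Nil nth_via_drop)

lemma length_le_list_encode: "length xs \<le> list_encode xs"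
  by (induction xs) (auto intro: order_trans[OF _ le_prod_encode_2])

lemma code_length_eq: "code_length (list_encode xs) = length xs"
  unfolding code_length_def code_drop_eq list_encode_eq_0_iff
  using length_le_list_encode[of xs] by (intro Least_equality) auto

lemma tc_code [tc_intros]:
  assumes "total_computable f"
  shows tc_code_length: "total_computable (\<lambda>x. code_length (f x))"
    and tc_code_nth: "total_computable g \<Longrightarrow> total_computable (\<lambda>x. code_nth (f x) (g x))"
  unfolding code_length_def code_nth_def code_drop_def
  by (intro tc_intros assms tc_comp[OF assms]; assumption)+

lemma tc_list_encode_map [tc_intros]:
  assumes "total_computable n" "total_computable (\<lambda>z. f (\<pi>1 z) (\<pi>2 z))"
  shows "total_computable (\<lambda>x. list_encode (map (f x) [0..<n x]))"
proof -
  have f: "total_computable (\<lambda>z. f (a z) (b z))" if "total_computable a" "total_computable b" for a b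
    using tc_comp[OF assms(2) tc_basic2(3)[OF that]] by simp
  \<comment> \<open>List codes grow at the front, so the recursion inserts the entries from the last
    index down to 0.\<close>
  have "total_computable (\<lambda>x. rec_nat 0 (\<lambda>i r. Suc (prod_encode (f x (n x - Suc i), r))) (n x))"
    by (intro tc_intros f assms tc_comp[OF assms(1)])
  moreover have "rec_nat 0 (\<lambda>i r. Suc (prod_encode (g (n - Suc i), r))) m = list_encode (map g [n - m..<n])"
    if "m \<le> n" for g :: "nat \<Rightarrow> nat" and m n
    using that
  proof (induction m)
    case (Suc m)
    then have "[n - Suc m..<n] = (n - Suc m) # [n - m..<n]"
      by (subst upt_conv_Cons) (auto simp: Suc_diff_Suc)
    then show ?case using Suc by simp
  qed simp
  ultimately show ?thesis by simp
qed

lemma query_decode [simp]: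
  "\<pi>1 (query n p k) = n"
  "\<pi>2 (query n p k) = list_encode (map p [0..<k])"
  by (simp_all add: query_def)

lemma code_nth_prefix: "code_nth (list_encode (map p [0..<k])) i = (if i < k then p i else 0)"
  by (simp add: code_nth_eq)

lemma code_length_prefix [simp]: "code_length (list_encode (map p [0..<k])) = k"
  by (simp add: code_length_eq)

section \<open>Codes of binary words\<close>

definition word_drop :: "nat \<Rightarrow> nat \<Rightarrow> nat" where
  "word_drop c n = rec_nat c (\<lambda>i r. (r - 1) div 2) n"

text \<open>Positions past the end of the word read as \<open>False\<close>, since
  \<open>word_drop\<close> stays at 0, the code of the empty word.\<close>

definition word_bit :: "nat \<Rightarrow> nat \<Rightarrow> bool" where
  "word_bit c n \<longleftrightarrow> word_drop c n \<noteq> 0 \<and> odd (word_drop c n - 1)"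

definition word_length :: "nat \<Rightarrow> nat" where
  "word_length c = (LEAST n. n = c \<or> word_drop c n = 0)"

lemma bl_of_nat_0 [simp]: "bl_of_nat 0 = []"
  by (subst bl_of_nat.simps) simp

lemma bl_of_nat_pos: "n \<noteq> 0 \<Longrightarrow> bl_of_nat n = odd (n - 1) # bl_of_nat ((n - 1) div 2)"
  by (subst bl_of_nat.simps) simp

lemma bl_of_nat_eq_Nil_iff: "bl_of_nat n = [] \<longleftrightarrow> n = 0"
  by (cases "n = 0") (auto simp: bl_of_nat_pos)

lemma bl_of_nat_word_drop: "bl_of_nat (word_drop c n) = drop n (bl_of_nat c)"
proof (induction n)
  case (Suc n)
  show ?case
  proof (cases "word_drop c n = 0")
    case True
    then have "drop n (bl_of_nat c) = []" using Suc by simp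
    then show ?thesis using True by (simp add: word_drop_def)
  next
    case False
    then have "bl_of_nat (word_drop c n) = odd (word_drop c n - 1) # bl_of_nat (word_drop c (Suc n))"
      by (simp add: bl_of_nat_pos word_drop_def)
    then show ?thesis using Suc by (metis drop_Suc list.sel(3) tl_drop)
  qed
qed (simp add: word_drop_def)

lemma word_drop_eq_0_iff: "word_drop c n = 0 \<longleftrightarrow> length (bl_of_nat c) \<le> n"
  using bl_of_nat_eq_Nil_iff[of "word_drop c n"] by (simp add: bl_of_nat_word_drop)

lemma word_bit_eq: "word_bit c n \<longleftrightarrow> n < length (bl_of_nat c) \<and> bl_of_nat c ! n"
proof (cases "n < length (bl_of_nat c)")
  case True
  then have "word_drop c n \<noteq> 0" by (simp add: word_drop_eq_0_iff)
  then have "drop n (bl_of_nat c) = odd (word_drop c n - 1) # bl_of_nat ((word_drop c n - 1) div 2)"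
    using bl_of_nat_pos[of "word_drop c n"] by (simp add: bl_of_nat_word_drop)
  then have "bl_of_nat c ! n = odd (word_drop c n - 1)" by (rule nth_via_drop)
  then show ?thesis using True \<open>word_drop c n \<noteq> 0\<close> by (simp add: word_bit_def)
next
  case False
  then show ?thesis by (simp add: word_bit_def word_drop_eq_0_iff)
qed

text \<open>Each letter removed from the front roughly halves \<open>n + 1\<close>. The upper bound
  makes the words of a given length a finite range of codes, over which \<open>level_count\<close>
  sums.\<close>

lemma length_bl_of_nat_bounds: "2 ^ length (bl_of_nat n) \<le> n + 1" "n + 1 < 2 ^ Suc (length (bl_of_nat n))"
proof -
  have "2 ^ length (bl_of_nat n) \<le> n + 1 \<and> n + 1 < 2 ^ Suc (length (bl_of_nat n))"
  proof (induction n rule: less_induct)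
    case (less n)
    show ?case
    proof (cases "n = 0")
      case False
      then have "(n - 1) div 2 < n" by simp
      from less[OF this] False show ?thesis
        by (simp add: bl_of_nat_pos) linarith
    qed simp
  qed
  then show "2 ^ length (bl_of_nat n) \<le> n + 1" "n + 1 < 2 ^ Suc (length (bl_of_nat n))" by auto
qed

lemma length_bl_of_nat_le: "length (bl_of_nat n) \<le> n"
  using length_bl_of_nat_bounds(1)[of n] less_exp[of "length (bl_of_nat n)"] by linarith

lemma word_length_eq: "word_length c = length (bl_of_nat c)"
  unfolding word_length_def word_drop_eq_0_iff
  using length_bl_of_nat_le[of c] by (intro Least_equality) auto

lemma bij_bl_of_nat: "bij bl_of_nat"
proof (rule bijI)
  show "inj bl_of_nat"
  proof (rule injI)
    fix m n assume "bl_of_nat m = bl_of_nat n"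
    then show "m = n"
    proof (induction m arbitrary: n rule: less_induct)
      case (less m)
      show ?case
      proof (cases "m = 0")
        case True
        then show ?thesis using less.prems bl_of_nat_eq_Nil_iff[of n] by simp
      next
        case False
        then have "n \<noteq> 0" using less.prems bl_of_nat_eq_Nil_iff by metis
        then have *: "odd (m - 1) = odd (n - 1)" "bl_of_nat ((m - 1) div 2) = bl_of_nat ((n - 1) div 2)"
          using less.prems False by (simp_all add: bl_of_nat_pos)
        have "(m - 1) div 2 = (n - 1) div 2" by (rule less.IH[OF _ *(2)]) (use False in simp)
        with *(1) have "m - 1 = n - 1"
          by (metis even_two_times_div_two odd_two_times_div_two_succ)
        then show ?thesis using False \<open>n \<noteq> 0\<close> by simp
      qed
    qed
  qed
  have "\<exists>n. bl_of_nat n = w" for w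
  proof (induction w)
    case (Cons b w)
    then obtain n where n: "bl_of_nat n = w" by blast
    have "bl_of_nat (2 * n + of_bool b + 1) = b # w"
      by (subst bl_of_nat_pos) (auto simp: n)
    then show ?case by blast
  qed (rule exI[of _ 0], simp)
  then show "surj bl_of_nat" by (metis surjI)
qed

lemma tc_word [tc_intros]:
  assumes "total_computable f"
  shows "total_computable (\<lambda>x. length (bl_of_nat (f x)))"
    and "total_computable g \<Longrightarrow> tcb (\<lambda>x. word_bit (f x) (g x))"
  unfolding word_length_eq[symmetric] word_length_def word_bit_def word_drop_def
  by (intro tc_intros tcb_eq_0 assms tc_comp[OF assms]; assumption)+

section \<open>Rational-valued functions\<close>

text \<open>Computable functions take values in the naturals, where subtraction truncates; signed
  numerators are therefore kept as formal differences, and \<open>Suc\<close> keeps the denominator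
  positive.\<close>

definition tcq :: "(nat \<Rightarrow> real) \<Rightarrow> bool" where
  "tcq f \<longleftrightarrow> (\<exists>a b d. total_computable a \<and> total_computable b \<and> total_computable d \<and>
     (\<forall>x. f x = (real (a x) - real (b x)) / real (Suc (d x))))"

lemma tcqI:
  assumes "total_computable a" "total_computable b" "total_computable d"
    "\<And>x. f x = (real (a x) - real (b x)) / real (Suc (d x))"
  shows "tcq f"
  using assms unfolding tcq_def by blast

lemma tcq_of_nat [tc_intros]: "total_computable f \<Longrightarrow> tcq (\<lambda>x. real (f x))"
  by (rule tcqI[of f "\<lambda>_. 0" "\<lambda>_. 0"]) (auto intro: tc_intros)

lemma tcq_numeral [tc_intros]: "tcq (\<lambda>x. 0)" "tcq (\<lambda>x. 1)" "tcq (\<lambda>x. numeral k)"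
  using tcq_of_nat[OF tc_const[of 0]] tcq_of_nat[OF tc_const[of 1]]
    tcq_of_nat[OF tc_const[of "numeral k"]] by simp_all

lemma tcq_arith [tc_intros]:
  assumes "tcq f" "tcq g"
  shows tcq_add: "tcq (\<lambda>x. f x + g x)" and tcq_diff: "tcq (\<lambda>x. f x - g x)"
    and tcq_mult: "tcq (\<lambda>x. f x * g x)"
proof -
  obtain a b d where f: "total_computable a" "total_computable b" "total_computable d"
    "\<And>x. f x = (real (a x) - real (b x)) / real (Suc (d x))"
    using assms(1) unfolding tcq_def by blast
  obtain a' b' d' where g: "total_computable a'" "total_computable b'" "total_computable d'"
    "\<And>x. g x = (real (a' x) - real (b' x)) / real (Suc (d' x))"
    using assms(2) unfolding tcq_def by blast
  let ?d = "\<lambda>x. Suc (d x) * Suc (d' x) - 1"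
  have d: "real (Suc (?d x)) = real (Suc (d x)) * real (Suc (d' x))" for x by (simp add: algebra_simps)
  have arith: "(A - B) / D + (A' - B') / D' = (A * D' + A' * D - (B * D' + B' * D)) / (D * D')"
    "(A - B) / D - (A' - B') / D' = (A * D' + B' * D - (B * D' + A' * D)) / (D * D')"
    "(A - B) / D * ((A' - B') / D') = (A * A' + B * B' - (A * B' + B * A')) / (D * D')"
    if "D > 0" "D' > 0" for A B D A' B' D' :: real
    using that by (simp_all add: field_simps)
  note fg = f(1-3) g(1-3)
  show "tcq (\<lambda>x. f x + g x)"
    by (rule tcqI[of "\<lambda>x. a x * Suc (d' x) + a' x * Suc (d x)" "\<lambda>x. b x * Suc (d' x) + b' x * Suc (d x)" ?d])
       (intro tc_intros fg | unfold d f(4) g(4) of_nat_add of_nat_mult, rule arith(1); simp)+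
  show "tcq (\<lambda>x. f x - g x)"
    by (rule tcqI[of "\<lambda>x. a x * Suc (d' x) + b' x * Suc (d x)" "\<lambda>x. b x * Suc (d' x) + a' x * Suc (d x)" ?d])
       (intro tc_intros fg | unfold d f(4) g(4) of_nat_add of_nat_mult, rule arith(2); simp)+
  show "tcq (\<lambda>x. f x * g x)"
    by (rule tcqI[of "\<lambda>x. a x * a' x + b x * b' x" "\<lambda>x. a x * b' x + b x * a' x" ?d])
       (intro tc_intros fg | unfold d f(4) g(4) of_nat_add of_nat_mult, rule arith(3); simp)+
qed

lemma tcq_half_power [tc_intros]:
  assumes "total_computable f"
  shows "tcq (\<lambda>x. (1 / 2) ^ f x)"
  by (rule tcqI[of "\<lambda>_. 1" "\<lambda>_. 0" "\<lambda>x. 2 ^ f x - 1"])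
     (auto intro!: tc_intros assms simp: power_divide)

lemma tcq_power [tc_intros]:
  assumes "total_computable f"
  shows "tcq (\<lambda>x. numeral k ^ f x)"
  using tcq_of_nat[OF tc_power[OF tc_const assms, of "numeral k"]] by simp

lemma int_decode_eq_diff:
  "real_of_int (int_decode n) = real (if even n then n div 2 else 0) - real (if even n then 0 else Suc (n div 2))"
  by (simp add: int_decode_def sum_decode_def)

lemma tcq_qnum [tc_intros]:
  assumes "total_computable f"
  shows "tcq (\<lambda>x. qnum (f x))"
proof (rule tcqI)
  let ?n = "\<lambda>x. \<pi>1 (f x)"
  show "qnum (f x) = (real (if even (?n x) then ?n x div 2 else 0) - real (if even (?n x) then 0 else Suc (?n x div 2)))
      / real (Suc (\<pi>2 (f x)))" for x
    unfolding qnum_def int_decode_eq_diff by (simp add: case_prod_beta add.commute)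
  have "tcb (\<lambda>x. even (?n x))"
    using tcb_not[OF tcb_odd] assms by (auto intro: tc_intros)
  then show "total_computable (\<lambda>x. if even (?n x) then ?n x div 2 else 0)"
    "total_computable (\<lambda>x. if even (?n x) then 0 else Suc (?n x div 2))"
    by (intro tc_intros assms; assumption)+
qed (intro tc_intros assms)

text \<open>This is how machines output rationals, both as entries of Cauchy names and as endpoints
  of basic intervals. Only the value of \<open>c x\<close> under \<open>qnum\<close> is controlled,
  not the code itself.\<close>

lemma tcq_code:
  assumes "tcq f"
  shows "\<exists>c. total_computable c \<and> (\<forall>x. qnum (c x) = f x)"
proof -
  obtain a b d where f: "total_computable a" "total_computable b" "total_computable d"
    "\<And>x. f x = (real (a x) - real (b x)) / real (Suc (d x))"
    using assms unfolding tcq_def by blast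
  \<comment> \<open>\<open>int_decode\<close> sends \<open>2 * k\<close> to \<open>k\<close> and,
    for positive \<open>k\<close>, \<open>2 * k - 1\<close> to \<open>- k\<close>.\<close>
  let ?c = "\<lambda>x. prod_encode (if b x \<le> a x then 2 * (a x - b x) else 2 * (b x - a x) - 1, d x)"
  have "total_computable ?c" by (intro tc_intros f)
  moreover have "real_of_int (int_decode (if n \<le> m then 2 * (m - n) else 2 * (n - m) - 1)) = real m - real n" for m n :: nat
  proof (cases "n \<le> m")
    case False
    then obtain k where "n = m + Suc k" by (metis less_imp_Suc_add not_le add_Suc_right)
    then show ?thesis by (simp add: int_decode_eq_diff)
  qed (simp add: int_decode_eq_diff of_nat_diff)
  then have "qnum (?c x) = f x" for x
    unfolding f(4) qnum_def by (simp add: add.commute)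
  ultimately show ?thesis by blast
qed

lemma tcb_less_real [tc_intros]:
  assumes "tcq f" "tcq g"
  shows "tcb (\<lambda>x. f x < g x)"
proof -
  obtain a b d where f: "total_computable a" "total_computable b" "total_computable d"
    "\<And>x. g x - f x = (real (a x) - real (b x)) / real (Suc (d x))"
    using tcq_diff[OF assms(2,1)] unfolding tcq_def by blast
  have "tcb (\<lambda>x. b x < a x)" by (intro tc_intros f)
  moreover have "b x < a x \<longleftrightarrow> f x < g x" for x
  proof -
    have "f x < g x \<longleftrightarrow> 0 < g x - f x" by simp
    also have "\<dots> \<longleftrightarrow> b x < a x" unfolding f(4) by (simp add: zero_less_divide_iff)
    finally show ?thesis by simp
  qed
  ultimately show ?thesis by simp
qed

section \<open>Machines and strong Weihrauch reductions\<close>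

definition computes :: "(nat \<Rightarrow> nat) \<Rightarrow> baire \<Rightarrow> baire \<Rightarrow> bool" where
  "computes M p q \<longleftrightarrow> (\<forall>n. (\<exists>k. M (query n p k) = Suc (q n)) \<and>
     (\<forall>k. M (query n p k) = 0 \<or> M (query n p k) = Suc (q n)))"

text \<open>The partial function of largest domain computed by \<open>M\<close>. With it a reduction
  can be given by two machines, whose correctness is checked only on the names that matter.\<close>

definition machine_fun :: "(nat \<Rightarrow> nat) \<Rightarrow> baire \<Rightarrow> baire option" where
  "machine_fun M p = (if \<exists>q. computes M p q then Some (THE q. computes M p q) else None)"

lemma computes_unique:
  assumes "computes M p q" "computes M p q'"
  shows "q = q'"
proof
  fix n
  obtain k where "M (query n p k) = Suc (q n)" using assms(1) unfolding computes_def by blast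
  moreover have "M (query n p k) = 0 \<or> M (query n p k) = Suc (q' n)"
    using assms(2) unfolding computes_def by blast
  ultimately show "q n = q' n" by auto
qed

lemma machine_fun_eq_Some_iff: "machine_fun M p = Some q \<longleftrightarrow> computes M p q"
proof (cases "\<exists>q. computes M p q")
  case True
  then obtain q' where q': "computes M p q'" by blast
  then have "(THE q. computes M p q) = q'" by (blast intro: computes_unique)
  then show ?thesis using q' computes_unique unfolding machine_fun_def by auto
qed (auto simp: machine_fun_def)

lemma baire_computable_iff:
  "baire_computable F \<longleftrightarrow> (\<exists>M. total_computable M \<and> (\<forall>p q. F p = Some q \<longrightarrow> computes M p q))"
  unfolding baire_computable_def computes_def by blast

lemma baire_computable_machine_fun: "total_computable M \<Longrightarrow> baire_computable (machine_fun M)"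
  unfolding baire_computable_iff machine_fun_eq_Some_iff by blast

text \<open>\<open>P\<close> tests whether the prefix read so far suffices for the digit asked for;
  until then the machine answers 0, which means \<open>not yet\<close>.\<close>

lemma computesI:
  assumes "\<And>n. \<exists>k. P (query n p k)"
    and "\<And>n k. P (query n p k) \<Longrightarrow> f (query n p k) = q n"
  shows "computes (\<lambda>x. of_bool (P x) * Suc (f x)) p q"
  unfolding computes_def
proof (intro allI conjI)
  fix n
  obtain k where "P (query n p k)" using assms(1) by blast
  then show "\<exists>k. of_bool (P (query n p k)) * Suc (f (query n p k)) = Suc (q n)"
    using assms(2) by (intro exI[of _ k]) simp
  show "of_bool (P (query n p k)) * Suc (f (query n p k)) = 0 \<or>
      of_bool (P (query n p k)) * Suc (f (query n p k)) = Suc (q n)" for k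
    using assms(2) by simp
qed

definition code_take :: "nat \<Rightarrow> nat \<Rightarrow> nat" where
  "code_take k l = list_encode (map (code_nth l) [0..<k])"

lemma tc_code_take [tc_intros]:
  assumes "total_computable f" "total_computable g"
  shows "total_computable (\<lambda>x. code_take (f x) (g x))"
  unfolding code_take_def by (intro tc_intros assms tc_comp[OF assms(2)])

lemma code_take_prefix:
  assumes "j \<le> k"
  shows "code_take j (list_encode (map p [0..<k])) = list_encode (map p [0..<j])"
  unfolding code_take_def using assms by (intro arg_cong[where f = list_encode]) (simp add: code_nth_prefix)

text \<open>Machines need not answer monotonically in the length of the prefix; \<open>monotonize\<close> remembers the
  first answer.\<close>

definition monotonize :: "(nat \<Rightarrow> nat) \<Rightarrow> nat \<Rightarrow> nat" where
  "monotonize M x = M (prod_encode (\<pi>1 x, code_take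
     (LEAST k. k = code_length (\<pi>2 x) \<or> M (prod_encode (\<pi>1 x, code_take k (\<pi>2 x))) \<noteq> 0) (\<pi>2 x)))"

lemma tc_monotonize:
  assumes "total_computable M"
  shows "total_computable (monotonize M)"
proof -
  have "total_computable (\<lambda>x. monotonize M x)"
    unfolding monotonize_def by (intro tc_intros tcb_not tcb_eq_0 tc_comp[OF assms])
  then show ?thesis .
qed

text \<open>Cutting a prefix of \<open>p\<close> yields a shorter prefix of \<open>p\<close>, so the
  search over cut codes is a search over earlier queries about the same \<open>p\<close>.\<close>

lemma monotonize_query:
  "monotonize M (query n p k) = M (query n p (LEAST j. j = k \<or> M (query n p j) \<noteq> 0 \<and> j \<le> k))"
proof -
  have eq: "(LEAST j. j = k \<or> P j) = (LEAST j. j = k \<or> Q j)" if "\<And>j. j \<le> k \<Longrightarrow> P j = Q j" for P Q :: "nat \<Rightarrow> bool"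
  proof (rule Least_equality[symmetric])
    let ?l = "LEAST j. j = k \<or> P j"
    have "?l = k \<or> P ?l" by (rule LeastI[of _ k]) simp
    moreover have "?l \<le> k" by (rule Least_le) simp
    ultimately show "?l = k \<or> Q ?l" using that by auto
    show "?l \<le> j" if j: "j = k \<or> Q j" for j
    proof (cases "j \<le> k")
      case True
      then show ?thesis using j \<open>\<And>j. j \<le> k \<Longrightarrow> P j = Q j\<close> by (intro Least_le) auto
    next
      case False
      then show ?thesis using \<open>?l \<le> k\<close> by simp
    qed
  qed
  have "(LEAST j. j = k \<or> M (prod_encode (n, code_take j (list_encode (map p [0..<k])))) \<noteq> 0)
      = (LEAST j. j = k \<or> M (query n p j) \<noteq> 0 \<and> j \<le> k)" (is "_ = ?l")
    by (rule eq) (simp add: code_take_prefix query_def)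
  moreover have "?l \<le> k" by (rule Least_le) simp
  ultimately show ?thesis
    unfolding monotonize_def by (simp add: code_take_prefix) (simp add: query_def)
qed

lemma monotonize_computes:
  assumes "computes M p q"
  shows "monotonize M (query n p k) = 0 \<or> monotonize M (query n p k) = Suc (q n)"
    and "\<exists>k0. \<forall>k\<ge>k0. monotonize M (query n p k) = Suc (q n)"
proof -
  have M: "M (query n p k) = 0 \<or> M (query n p k) = Suc (q n)" for n k
    using assms unfolding computes_def by blast
  then show "monotonize M (query n p k) = 0 \<or> monotonize M (query n p k) = Suc (q n)"
    unfolding monotonize_query by blast
  obtain k0 where k0: "M (query n p k0) = Suc (q n)" using assms unfolding computes_def by blast
  show "\<exists>k0. \<forall>k\<ge>k0. monotonize M (query n p k) = Suc (q n)"
  proof (intro exI allI impI)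
    fix k assume "k0 \<le> k"
    let ?P = "\<lambda>j. j = k \<or> M (query n p j) \<noteq> 0 \<and> j \<le> k"
    have P: "?P k0" using k0 \<open>k0 \<le> k\<close> by simp
    have "?P (Least ?P)" by (rule LeastI[of ?P, OF P])
    moreover have "Least ?P \<le> k0" by (rule Least_le[of ?P, OF P])
    ultimately have "M (query n p (Least ?P)) \<noteq> 0"
      using k0 \<open>k0 \<le> k\<close> by (metis le_antisym nat.distinct(1))
    then show "monotonize M (query n p k) = Suc (q n)"
      unfolding monotonize_query using M[of n "Least ?P"] by simp
  qed
qed

text \<open>From a prefix of \<open>p\<close>, \<open>out\<close> collects the initial segment of
  \<open>q\<close> for which \<open>M\<close> has answered without a gap, and \<open>N\<close> is
  run on it. Monotonizing \<open>M\<close> lets these segments become arbitrarily long. Monotonizing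
  \<open>N\<close> matters because \<open>len\<close> may skip the very length at which
  \<open>N\<close> gives its answer.\<close>

lemma computes_comp:
  assumes "total_computable M" "total_computable N"
  obtains R where "total_computable R" "\<And>p q r. computes M p q \<Longrightarrow> computes N q r \<Longrightarrow> computes R p r"
proof -
  define v where "v l i = monotonize M (prod_encode (i, l))" for l i
  define len where "len l = (LEAST i. i = code_length l \<or> v l i = 0)" for l
  define out where "out l = list_encode (map (\<lambda>i. v l i - 1) [0..<len l])" for l
  define R where "R x = monotonize N (prod_encode (\<pi>1 x, out (\<pi>2 x)))" for x
  have v: "total_computable (\<lambda>x. v (f x) (g x))" if "total_computable f" "total_computable g" for f g
    unfolding v_def by (intro tc_comp[OF tc_monotonize] tc_intros that assms)
  have len: "total_computable (\<lambda>x. len (f x))" if "total_computable f" for f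
    unfolding len_def by (intro tc_intros v tcb_eq_0 that tc_comp[OF that])
  have out: "total_computable (\<lambda>x. out (f x))" if "total_computable f" for f
    unfolding out_def by (intro tc_intros v len that tc_comp[OF that])
  show thesis
  proof
    have "total_computable (\<lambda>x. R x)"
      unfolding R_def by (intro tc_comp[OF tc_monotonize] tc_intros out assms)
    then show "total_computable R" .
    fix p q r assume Mpq: "computes M p q" and Nqr: "computes N q r"
    let ?l = "\<lambda>k. list_encode (map p [0..<k])"
    have v_eq: "v (?l k) i = monotonize M (query i p k)" for k i
      by (simp add: v_def query_def)
    have v_len: "v (?l k) i = Suc (q i)" if "i < len (?l k)" for k i
      using not_less_Least[of i "\<lambda>i. i = code_length (?l k) \<or> v (?l k) i = 0"] that
        monotonize_computes(1)[OF Mpq, of i k] by (auto simp: len_def v_eq)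
    have out_eq: "out (?l k) = list_encode (map q [0..<len (?l k)])" for k
      unfolding out_def by (intro arg_cong[where f = list_encode]) (simp add: v_len)
    have R_eq: "R (query n p k) = monotonize N (query n q (len (?l k)))" for n k
      unfolding R_def by (simp add: out_eq) (simp add: query_def)
    have unb: "\<exists>k. j \<le> len (?l k)" for j
    proof -
      have "\<exists>k1. \<forall>k\<ge>k1. \<forall>i<j. v (?l k) i \<noteq> 0"
      proof (induction j)
        case (Suc j)
        then obtain k1 where k1: "\<forall>k\<ge>k1. \<forall>i<j. v (?l k) i \<noteq> 0" by blast
        obtain k2 where "\<forall>k\<ge>k2. v (?l k) j = Suc (q j)"
          using monotonize_computes(2)[OF Mpq] unfolding v_eq by blast
        then have "\<forall>k\<ge>max k1 k2. \<forall>i<Suc j. v (?l k) i \<noteq> 0"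
          using k1 by (auto simp: less_Suc_eq)
        then show ?case by blast
      qed simp
      then obtain k1 where k1: "\<forall>k\<ge>k1. \<forall>i<j. v (?l k) i \<noteq> 0" by blast
      \<comment> \<open>\<open>len\<close> is capped by the length of the prefix, so besides the
        first \<open>j\<close> answers a prefix of length at least \<open>j\<close> is
        required.\<close>
      let ?k = "max k1 j"
      let ?P = "\<lambda>i. i = code_length (?l ?k) \<or> v (?l ?k) i = 0"
      have "?P (len (?l ?k))" unfolding len_def by (rule LeastI[of ?P "?k"]) simp
      then have "j \<le> len (?l ?k)"
        using k1[rule_format, of ?k "len (?l ?k)"] by (auto simp: not_less[symmetric])
      then show ?thesis by blast
    qed
    show "computes R p r"
      unfolding computes_def R_eq
    proof (intro allI conjI)
      fix n
      obtain k0 where "\<forall>k\<ge>k0. monotonize N (query n q k) = Suc (r n)"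
        using monotonize_computes(2)[OF Nqr] by blast
      then show "\<exists>k. monotonize N (query n q (len (?l k))) = Suc (r n)"
        using unb[of k0] by blast
      show "monotonize N (query n q (len (?l k))) = 0 \<or> monotonize N (query n q (len (?l k))) = Suc (r n)" for k
        by (rule monotonize_computes(1)[OF Nqr])
    qed
  qed
qed

lemma baire_computable_pcomp:
  assumes "baire_computable F" "baire_computable G"
  shows "baire_computable (pcomp G F)"
proof -
  obtain M N where M: "total_computable M" "\<And>p q. F p = Some q \<Longrightarrow> computes M p q"
    and N: "total_computable N" "\<And>p q. G p = Some q \<Longrightarrow> computes N p q"
    using assms unfolding baire_computable_iff by blast
  obtain R where "total_computable R" "\<And>p q r. computes M p q \<Longrightarrow> computes N q r \<Longrightarrow> computes R p r"
    using computes_comp[OF M(1) N(1)] by blast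
  then show ?thesis
    unfolding baire_computable_iff pcomp_def using M(2) N(2) by (metis bind_eq_Some_conv)
qed

lemma pcomp_assoc: "pcomp (pcomp H G) F = pcomp H (pcomp G F)"
proof
  show "pcomp (pcomp H G) F p = pcomp H (pcomp G F) p" for p
    by (cases "F p") (simp_all add: pcomp_def)
qed

lemma sW_le_trans:
  assumes "sW_le f g" "sW_le g h"
  shows "sW_le f h"
proof -
  obtain H K where HK: "baire_computable H" "baire_computable K"
    "\<And>G. realizes G g \<Longrightarrow> realizes (pcomp H (pcomp G K)) f"
    using assms(1) unfolding sW_le_def by blast
  obtain H' K' where HK': "baire_computable H'" "baire_computable K'"
    "\<And>G. realizes G h \<Longrightarrow> realizes (pcomp H' (pcomp G K')) g"
    using assms(2) unfolding sW_le_def by blast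
  have "realizes (pcomp (pcomp H H') (pcomp G (pcomp K' K))) f" if "realizes G h" for G
    using HK(3)[OF HK'(3)[OF that]] by (simp add: pcomp_assoc)
  moreover have "baire_computable (pcomp H H')" "baire_computable (pcomp K' K)"
    using HK(1,2) HK'(1,2) by (auto intro: baire_computable_pcomp)
  ultimately show ?thesis
    unfolding sW_le_def by (intro exI[of _ "pcomp H H'"] exI[of _ "pcomp K' K"]) simp
qed

text \<open>A realizer may return any name \<open>q\<close> of any solution, so quantifying over all
  of these eliminates the realizer. That \<open>H\<close> is run on \<open>q\<close> alone is what
  makes the reduction strong.\<close>

lemma sW_leI:
  assumes "total_computable H" "total_computable K"
    and "\<And>p x. inrep f p x \<Longrightarrow> x \<in> pdom f \<Longrightarrow>
      \<exists>p' x'. computes K p p' \<and> inrep g p' x' \<and> x' \<in> pdom g \<and>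
        (\<forall>q y. outrep g q y \<longrightarrow> y \<in> prel g x' \<longrightarrow>
          (\<exists>q' y'. computes H q q' \<and> outrep f q' y' \<and> y' \<in> prel f x))"
  shows "sW_le f g"
  unfolding sW_le_def
proof (intro exI conjI allI impI)
  show "baire_computable (machine_fun H)" "baire_computable (machine_fun K)"
    using assms(1,2) by (auto intro: baire_computable_machine_fun)
  fix G assume G: "realizes G g"
  show "realizes (pcomp (machine_fun H) (pcomp G (machine_fun K))) f"
    unfolding realizes_def
  proof (intro allI impI)
    fix p x assume "inrep f p x \<and> x \<in> pdom f"
    then obtain p' x' where p': "computes K p p'" "inrep g p' x'" "x' \<in> pdom g"
      and *: "\<And>q y. outrep g q y \<Longrightarrow> y \<in> prel g x' \<Longrightarrow>
          \<exists>q' y'. computes H q q' \<and> outrep f q' y' \<and> y' \<in> prel f x"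
      using assms(3) by blast
    obtain q y where "G p' = Some q" "outrep g q y" "y \<in> prel g x'"
      using G p'(2,3) unfolding realizes_def by blast
    moreover obtain q' y' where "computes H q q'" "outrep f q' y'" "y' \<in> prel f x"
      using *[OF \<open>outrep g q y\<close> \<open>y \<in> prel g x'\<close>] by blast
    ultimately show "\<exists>q. pcomp (machine_fun H) (pcomp G (machine_fun K)) p = Some q \<and>
        (\<exists>y. outrep f q y \<and> y \<in> prel f x)"
      using p'(1) unfolding pcomp_def machine_fun_eq_Some_iff[symmetric] by auto
  qed
qed

section \<open>The uniform measure on Cantor space\<close>

interpretation coin: sequence_space "measure_pmf (bernoulli_pmf (1 / 2))"
  by unfold_locales

interpretation cantor: prob_space cantor_measure
  unfolding cantor_measure_def by (rule prob_space_PiM) unfold_locales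

lemma space_cantor [simp]: "space cantor_measure = UNIV"
  by (simp add: cantor_measure_def space_PiM)

lemma mem_cyl_iff: "x \<in> cyl w \<longleftrightarrow> (\<forall>i<length w. x i = w ! i)"
  unfolding cyl_def by (simp only: list_eq_iff_nth_eq[of "map x [0..<length w]"] mem_Collect_eq) simp

lemma coordinate_measurable [measurable]:
  "(\<lambda>x. x i) \<in> measurable cantor_measure (count_space UNIV)"
proof -
  have "(\<lambda>x. x i) \<in> measurable cantor_measure (measure_pmf (bernoulli_pmf (1 / 2)))"
    unfolding cantor_measure_def by (rule measurable_component_singleton) simp
  then show ?thesis by simp
qed

lemma cyl_measurable [measurable]: "cyl w \<in> sets cantor_measure"
proof -
  have "cyl w = {x \<in> space cantor_measure. \<forall>i\<in>{..<length w}. x i = w ! i}"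
    by (auto simp: mem_cyl_iff)
  also have "\<dots> \<in> sets cantor_measure" by measurable
  finally show ?thesis .
qed

lemma measure_cyl: "measure cantor_measure (cyl w) = (1 / 2) ^ length w"
proof -
  have "cyl w = {x \<in> space cantor_measure. \<forall>i\<in>{..<length w}. x i \<in> {w ! i}}"
    by (auto simp: mem_cyl_iff)
  then have "emeasure cantor_measure (cyl w) =
      (\<Prod>i<length w. emeasure (measure_pmf (bernoulli_pmf (1 / 2))) {w ! i})"
    unfolding cantor_measure_def by (simp only:) (rule coin.emeasure_PiM_Collect; simp)
  also have "\<dots> = (\<Prod>i<length w. ennreal (1 / 2))"
  proof (intro prod.cong refl)
    show "emeasure (measure_pmf (bernoulli_pmf (1 / 2))) {w ! i} = ennreal (1 / 2)" for i
      by (cases "w ! i") (simp_all add: emeasure_pmf_single)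
  qed
  also have "\<dots> = ennreal ((1 / 2) ^ length w)"
    using ennreal_power[of "1 / 2" "length w"] by simp
  finally show ?thesis
    by (simp add: measure_def)
qed

lemma word_level_card: "finite {w \<in> T. length w = n}" for T :: "bool list set"
  by (rule finite_subset[OF _ finite_lists_length_eq[of UNIV n]]) auto

lemma measure_level:
  shows level_measurable [measurable]: "{x. map x [0..<n] \<in> T} \<in> sets cantor_measure"
    and "measure cantor_measure {x. map x [0..<n] \<in> T} = card {w \<in> T. length w = n} * (1 / 2) ^ n"
proof -
  have eq: "{x. map x [0..<n] \<in> T} = (\<Union>w\<in>{w \<in> T. length w = n}. cyl w)"
    by (auto simp: cyl_def)
  show "{x. map x [0..<n] \<in> T} \<in> sets cantor_measure"
    unfolding eq by (intro sets.finite_UN word_level_card) auto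
  have "disjoint_family_on cyl {w \<in> T. length w = n}"
    by (auto simp: disjoint_family_on_def cyl_def)
  then have "measure cantor_measure (\<Union>w\<in>{w \<in> T. length w = n}. cyl w) =
      (\<Sum>w\<in>{w \<in> T. length w = n}. measure cantor_measure (cyl w))"
    by (intro cantor.finite_measure_finite_Union word_level_card) auto
  then show "measure cantor_measure {x. map x [0..<n] \<in> T} = card {w \<in> T. length w = n} * (1 / 2) ^ n"
    unfolding eq by (simp add: measure_cyl)
qed

lemma paths_eq_Inter: "paths T = (\<Inter>n. {x. map x [0..<n] \<in> T})"
  by (auto simp: paths_def)

lemma paths_measurable [measurable]: "paths T \<in> sets cantor_measure"
  unfolding paths_eq_Inter by measurable

lemma measure_paths_le: "measure cantor_measure (paths T) \<le> card {w \<in> T. length w = n} * (1 / 2) ^ n"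
  unfolding measure_level(2)[symmetric]
  by (rule cantor.finite_measure_mono) (auto simp: paths_def)

text \<open>Closure under prefixes makes the level sets decrease, and continuity from above applies.
  With \<open>measure_paths_le\<close> this shows that a lower bound on the measure is false iff a
  count at some level refutes it.\<close>

lemma measure_paths_limit:
  assumes "is_tree T"
  shows "(\<lambda>n. card {w \<in> T. length w = n} * (1 / 2) ^ n) \<longlonglongrightarrow> measure cantor_measure (paths T)"
  unfolding paths_eq_Inter measure_level(2)[symmetric]
proof (rule cantor.finite_Lim_measure_decseq)
  show "decseq (\<lambda>n. {x. map x [0..<n] \<in> T})"
  proof (rule decseq_SucI, safe)
    fix n and x :: "nat \<Rightarrow> bool" assume "map x [0..<Suc n] \<in> T"
    then show "map x [0..<n] \<in> T"
      using assms unfolding is_tree_def by (metis map_append upt_Suc_append zero_le)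
  qed
qed auto

lemma rep_neg_measurable:
  assumes "rep_neg bas p A" "\<And>n. bas n \<in> sets M" "space M = UNIV"
  shows "A \<in> sets M"
proof -
  have "A = space M - (\<Union>i\<in>{i. 0 < p i}. bas (p i - 1))"
    using assms unfolding rep_neg_def by auto
  also have "\<dots> \<in> sets M" using assms(2) by (intro sets.Diff sets.countable_UN') auto
  finally show ?thesis .
qed

lemma bas_natcantor_measurable: "bas_natcantor n \<in> sets natcantor_measure"
  unfolding bas_natcantor_def natcantor_measure_def by (auto simp: case_prod_beta intro!: pair_measureI)

lemma space_natcantor: "space natcantor_measure = UNIV"
  by (simp add: natcantor_measure_def space_pair_measure)

lemma emeasure_natcantor:
  assumes "A \<in> sets natcantor_measure"
  shows "emeasure natcantor_measure A = (\<Sum>n. emeasure cantor_measure (Pair n -` A))"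
  using assms unfolding natcantor_measure_def
  by (subst cantor.emeasure_pair_measure_alt) (simp_all add: nn_integral_count_space_nat)

lemma emeasure_natcantor_pos_iff:
  assumes "A \<in> sets natcantor_measure"
  shows "0 < emeasure natcantor_measure A \<longleftrightarrow> (\<exists>n. 0 < emeasure cantor_measure (Pair n -` A))"
  unfolding emeasure_natcantor[OF assms]
  by (simp add: zero_less_iff_neq_zero suminf_eq_zero_iff)

lemma section_measurable: "A \<in> sets natcantor_measure \<Longrightarrow> Pair n -` A \<in> sets cantor_measure"
  unfolding natcantor_measure_def by (rule sets_Pair1)

text \<open>Splicing the first \<open>length w\<close> bits of one sequence before another carries
  the product measure to the uniform measure, and it maps \<open>cyl w \<times> A\<close> into
  \<open>B\<close>. So \<open>B\<close> has at least \<open>(1 / 2) ^ length w\<close> times the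
  measure of \<open>A\<close>. Only the first \<open>length w\<close> values of \<open>(!) w\<close>
  are read.\<close>

lemma measure_prepend_pos:
  assumes A: "A \<in> sets cantor_measure" "0 < emeasure cantor_measure A"
    and B: "B \<in> sets cantor_measure" and sub: "\<And>x. x \<in> A \<Longrightarrow> comb_seq (length w) ((!) w) x \<in> B"
  shows "0 < emeasure cantor_measure B"
proof -
  let ?f = "\<lambda>(x, y). comb_seq (length w) x y"
  have f: "?f \<in> measurable (cantor_measure \<Otimes>\<^sub>M cantor_measure) cantor_measure"
    unfolding cantor_measure_def by (rule measurable_comb_seq)
  have "0 < ennreal ((1 / 2) ^ length w)" by simp
  then have "0 < ennreal ((1 / 2) ^ length w) * emeasure cantor_measure A"
    using A(2) by (simp add: ennreal_zero_less_mult_iff)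
  also have "\<dots> = emeasure cantor_measure (cyl w) * emeasure cantor_measure A"
    by (simp add: cantor.emeasure_eq_measure measure_cyl)
  also have "\<dots> = emeasure (cantor_measure \<Otimes>\<^sub>M cantor_measure) (cyl w \<times> A)"
    using A(1) by (simp add: cantor.emeasure_pair_measure_Times)
  also have "\<dots> \<le> emeasure (cantor_measure \<Otimes>\<^sub>M cantor_measure)
      (?f -` B \<inter> space (cantor_measure \<Otimes>\<^sub>M cantor_measure))"
  proof (rule emeasure_mono)
    show "?f -` B \<inter> space (cantor_measure \<Otimes>\<^sub>M cantor_measure) \<in> sets (cantor_measure \<Otimes>\<^sub>M cantor_measure)"
      using f B by (rule measurable_sets)
    show "cyl w \<times> A \<subseteq> ?f -` B \<inter> space (cantor_measure \<Otimes>\<^sub>M cantor_measure)"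
    proof safe
      fix x y assume "x \<in> cyl w" "y \<in> A"
      then have "comb_seq (length w) x y = comb_seq (length w) ((!) w) y"
        by (auto simp: fun_eq_iff comb_seq_def mem_cyl_iff)
      then show "(x, y) \<in> ?f -` B" using sub[OF \<open>y \<in> A\<close>] by simp
      show "(x, y) \<in> space (cantor_measure \<Otimes>\<^sub>M cantor_measure)" by (simp add: space_pair_measure)
    qed
  qed
  also have "\<dots> = emeasure (distr (cantor_measure \<Otimes>\<^sub>M cantor_measure) cantor_measure ?f) B"
    using f B by (simp add: emeasure_distr)
  also have "\<dots> = emeasure cantor_measure B"
    using coin.PiM_comb_seq[of "length w"] by (simp add: cantor_measure_def)
  finally show ?thesis .
qed

section \<open>Binary expansion and Lebesgue measure\<close>

primrec bin_val :: "nat \<Rightarrow> (nat \<Rightarrow> bool) \<Rightarrow> nat" where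
  "bin_val 0 x = 0"
| "bin_val (Suc n) x = 2 * bin_val n x + of_bool (x n)"

definition bin_real :: "(nat \<Rightarrow> bool) \<Rightarrow> real" where
  "bin_real x = (\<Sum>n. of_bool (x n) * (1 / 2) ^ Suc n)"

lemma bin_val_less: "bin_val n x < 2 ^ n"
  by (induction n) (auto simp: of_bool_def)

lemma bin_val_cong: "(\<And>i. i < n \<Longrightarrow> x i = y i) \<Longrightarrow> bin_val n x = bin_val n y"
  by (induction n) auto

lemma bin_val_eq_iff: "bin_val n x = bin_val n y \<longleftrightarrow> (\<forall>i<n. x i = y i)"
proof (induction n)
  case (Suc n)
  have "2 * a + of_bool b = 2 * c + of_bool d \<longleftrightarrow> a = c \<and> b = d" for a c :: nat and b d
    by (cases b; cases d) (auto, presburger+)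
  then show ?case using Suc by (auto simp: less_Suc_eq)
qed simp

lemma bin_val_surj: "j < 2 ^ n \<Longrightarrow> \<exists>x. bin_val n x = j"
proof (induction n arbitrary: j)
  case (Suc n)
  then have "j div 2 < 2 ^ n" by auto
  then obtain x where x: "bin_val n x = j div 2" using Suc by blast
  have "bin_val n (x(n := odd j)) = bin_val n x" by (rule bin_val_cong) auto
  then have "bin_val (Suc n) (x(n := odd j)) = j" using x by (auto simp: of_bool_def)
  then show ?case by blast
qed simp

lemma bin_val_eq_cyl: "{y. bin_val n y = bin_val n x} = cyl (map x [0..<n])"
  by (auto simp: bin_val_eq_iff mem_cyl_iff)

lemma measure_bin_val_less:
  assumes "k \<le> 2 ^ n"
  shows "{x. bin_val n x < k} \<in> sets cantor_measure"
    and "measure cantor_measure {x. bin_val n x < k} = k * (1 / 2) ^ n"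
proof -
  have 1: "\<exists>w. length w = n \<and> {x. bin_val n x = j} = cyl w" if "j < k" for j
  proof -
    have "j < 2 ^ n" using that assms by simp
    then obtain y where "bin_val n y = j" using bin_val_surj by blast
    then show ?thesis using bin_val_eq_cyl[of n y] by (intro exI[of _ "map y [0..<n]"]) simp
  qed
  have *: "{x. bin_val n x = j} \<in> sets cantor_measure"
    "measure cantor_measure {x. bin_val n x = j} = (1 / 2) ^ n" if "j < k" for j
    using 1[OF that] measure_cyl by auto
  have eq: "{x. bin_val n x < k} = (\<Union>j<k. {x. bin_val n x = j})" by auto
  show "{x. bin_val n x < k} \<in> sets cantor_measure"
    unfolding eq using * by (intro sets.finite_UN) auto
  have "measure cantor_measure {x. bin_val n x < k} = (\<Sum>j<k. measure cantor_measure {x. bin_val n x = j})"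
    unfolding eq using * by (intro cantor.finite_measure_finite_Union) (auto simp: disjoint_family_on_def)
  then show "measure cantor_measure {x. bin_val n x < k} = k * (1 / 2) ^ n" using * by simp
qed

lemma bin_summable: "summable (\<lambda>n. of_bool (x n) * (1 / 2) ^ Suc n :: real)"
  by (rule summable_comparison_test[OF _ power_half_series[THEN sums_summable]]) auto

text \<open>The first \<open>n\<close> bits contribute \<open>bin_val n x * (1 / 2) ^ n\<close>, and
  the tail of the series is at most \<open>(1 / 2) ^ n\<close>. Both bounds are attained, by
  constant tails, so neither inequality can be strict.\<close>

lemma bin_real_bounds: "bin_val n x * (1 / 2) ^ n \<le> bin_real x" "bin_real x \<le> (real (bin_val n x) + 1) * (1 / 2) ^ n"
proof -
  let ?f = "\<lambda>n. of_bool (x n) * (1 / 2) ^ Suc n :: real"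
  have fin: "(\<Sum>i<n. ?f i) = bin_val n x * (1 / 2) ^ n"
    by (induction n) (auto simp: field_simps)
  have split: "bin_real x = (\<Sum>i. ?f (i + n)) + (\<Sum>i<n. ?f i)"
    unfolding bin_real_def by (rule suminf_split_initial_segment[OF bin_summable])
  have sm: "summable (\<lambda>i. ?f (i + n))"
    by (rule summable_ignore_initial_segment[OF bin_summable])
  have "0 \<le> (\<Sum>i. ?f (i + n))" by (rule suminf_nonneg[OF sm]) simp
  then show "bin_val n x * (1 / 2) ^ n \<le> bin_real x" unfolding split fin by simp
  have "(\<lambda>i. (1 / 2) ^ n * (1 / 2) ^ Suc i) sums ((1 / 2 :: real) ^ n * 1)"
    by (rule sums_mult[OF power_half_series])
  then have g: "(\<lambda>i. (1 / 2) ^ Suc (i + n)) sums ((1 / 2 :: real) ^ n)"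
    by (simp add: power_add mult.commute)
  have "(\<Sum>i. ?f (i + n)) \<le> (\<Sum>i. (1 / 2) ^ Suc (i + n))"
    by (rule suminf_le[OF _ sm sums_summable[OF g]]) simp
  also have "\<dots> = (1 / 2) ^ n" using g by (rule sums_unique[symmetric])
  finally show "bin_real x \<le> (real (bin_val n x) + 1) * (1 / 2) ^ n"
    unfolding split fin by (simp add: algebra_simps)
qed

lemma bin_real_measurable [measurable]: "bin_real \<in> borel_measurable cantor_measure"
proof -
  have "(\<lambda>x. \<Sum>n. of_bool (x n) * (1 / 2) ^ Suc n :: real) \<in> borel_measurable cantor_measure"
    by measurable
  then show ?thesis unfolding bin_real_def[abs_def] .
qed

lemma bin_real_range: "0 \<le> bin_real x" "bin_real x \<le> 1"
  using bin_real_bounds(1)[of 0 x] bin_real_bounds(2)[of x 0] by simp_all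

text \<open>With \<open>j\<close> the integer part of \<open>t * 2 ^ n\<close>, the event lies
  between \<open>bin_val n x < j\<close> and \<open>bin_val n x < Suc j\<close>, whose measures are
  within \<open>(1 / 2) ^ n\<close> of \<open>t\<close>. The hypothesis \<open>t < 1\<close> ensures
  \<open>Suc j \<le> 2 ^ n\<close>, so that these are unions of cylinders of the right
  number.\<close>

lemma cdf_bin_real:
  assumes "0 \<le> t" "t < 1"
  shows "measure cantor_measure {x. bin_real x \<le> t} = t"
proof -
  let ?m = "measure cantor_measure {x. bin_real x \<le> t}"
  have meas: "{x. bin_real x \<le> t} \<in> sets cantor_measure"
  proof -
    have "{x \<in> space cantor_measure. bin_real x \<le> t} \<in> sets cantor_measure" by measurable
    then show ?thesis by simp
  qed
  have bound: "\<bar>?m - t\<bar> \<le> (1 / 2) ^ n" for n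
  proof -
    define j where "j = nat \<lfloor>t * 2 ^ n\<rfloor>"
    have j: "real j \<le> t * 2 ^ n" "t * 2 ^ n < real j + 1"
      using assms(1) by (auto simp: j_def)
    have "t * 2 ^ n < 2 ^ n" using assms(2) by simp
    then have "real j < 2 ^ n" using j(1) by linarith
    then have jn: "Suc j \<le> 2 ^ n"
      by (metis Suc_leI of_nat_less_iff of_nat_numeral of_nat_power)
    have "{x. bin_real x \<le> t} \<subseteq> {x. bin_val n x < Suc j}"
    proof safe
      fix x assume "bin_real x \<le> t"
      then have "bin_val n x * (1 / 2) ^ n \<le> t" using bin_real_bounds(1)[of n x] by linarith
      then have "real (bin_val n x) \<le> t * 2 ^ n" by (simp add: field_simps power_divide)
      then show "bin_val n x < Suc j" using j by linarith
    qed
    then have "?m \<le> Suc j * (1 / 2) ^ n"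
      unfolding measure_bin_val_less(2)[OF jn, symmetric]
      by (intro cantor.finite_measure_mono measure_bin_val_less(1)[OF jn])
    also have "\<dots> \<le> (t * 2 ^ n + 1) * (1 / 2) ^ n"
      using j by (intro mult_right_mono) auto
    also have "\<dots> = t + (1 / 2) ^ n" by (simp add: field_simps power_divide)
    finally have 1: "?m \<le> t + (1 / 2) ^ n" .
    have jn': "j \<le> 2 ^ n" using jn by simp
    have sub: "{x. bin_val n x < j} \<subseteq> {x. bin_real x \<le> t}"
    proof safe
      fix x assume "bin_val n x < j"
      then have "real (bin_val n x) + 1 \<le> t * 2 ^ n" using j by linarith
      then have "(real (bin_val n x) + 1) * (1 / 2) ^ n \<le> t" by (simp add: field_simps power_divide)
      then show "bin_real x \<le> t" using bin_real_bounds(2)[of x n] by linarith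
    qed
    have "t - (1 / 2) ^ n = (t * 2 ^ n - 1) * (1 / 2) ^ n" by (simp add: field_simps power_divide)
    also have "\<dots> \<le> j * (1 / 2) ^ n" using j by (intro mult_right_mono) auto
    also have "\<dots> \<le> ?m"
      unfolding measure_bin_val_less(2)[OF jn', symmetric]
      by (intro cantor.finite_measure_mono sub meas)
    finally show ?thesis using 1 by linarith
  qed
  have "(\<lambda>n. (1 / 2 :: real) ^ n) \<longlonglongrightarrow> 0" by (rule LIMSEQ_power_zero) simp
  then have "\<bar>?m - t\<bar> \<le> 0"
    by (rule LIMSEQ_le_const) (use bound in blast)
  then show ?thesis by simp
qed

lemma distr_bin_real: "distr cantor_measure borel bin_real = uniform_measure lborel {0..1}"
proof (rule cdf_unique)
  show "real_distribution (distr cantor_measure borel bin_real)"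
    by (intro cantor.real_distribution_distr) simp
  have u: "prob_space (uniform_measure lborel {0..1 :: real})"
    by (rule prob_space_uniform_measure) auto
  then show "real_distribution (uniform_measure lborel {0..1})"
    by (simp add: real_distribution_def real_distribution_axioms_def)
  show "cdf (distr cantor_measure borel bin_real) = cdf (uniform_measure lborel {0..1})"
  proof
    fix t :: real
    have "cdf (distr cantor_measure borel bin_real) t = measure cantor_measure {x. bin_real x \<le> t}"
      unfolding cdf_def by (subst measure_distr) (auto simp: vimage_def)
    moreover have "cdf (uniform_measure lborel {0..1}) t = measure lborel ({0..1} \<inter> {..t})"
      unfolding cdf_def by (subst measure_uniform_measure) auto
    moreover consider "t < 0" | "0 \<le> t" "t < 1" | "1 \<le> t" by linarith
    then have "measure cantor_measure {x. bin_real x \<le> t} = measure lborel ({0..1} \<inter> {..t})"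
    proof cases
      case 1
      then have "{x. bin_real x \<le> t} = {}" "{0..1} \<inter> {..t} = {}"
        using bin_real_range(1) by (auto simp: not_le intro: less_le_trans)
      then show ?thesis by simp
    next
      case 2
      then have "{0..1} \<inter> {..t} = {0..t}" by auto
      then show ?thesis using 2 by (simp add: cdf_bin_real)
    next
      case 3
      then have "{x. bin_real x \<le> t} = UNIV" "{0..1} \<inter> {..t} = {0..1}"
        using bin_real_range(2) by (auto intro: order_trans)
      then show ?thesis using cantor.prob_space by simp
    qed
    ultimately show "cdf (distr cantor_measure borel bin_real) t = cdf (uniform_measure lborel {0..1}) t" by simp
  qed
qed

text \<open>Translation invariance moves the unit interval to \<open>c\<close>. At integers
  \<open>c\<close> this transfers positive measure between a column and a piece of the line, in both
  directions.\<close>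

lemma emeasure_bin_real_shift:
  assumes [measurable]: "A \<in> sets borel"
  shows "emeasure cantor_measure {x. c + bin_real x \<in> A} = emeasure lborel (A \<inter> {c..c + 1})"
proof -
  let ?B = "{t. c + t \<in> A}"
  have B: "?B \<in> sets borel"
    using measurable_sets[of "(+) c" borel borel A] by (simp add: vimage_def)
  have "emeasure cantor_measure {x. c + bin_real x \<in> A} = emeasure (distr cantor_measure borel bin_real) ?B"
    using B by (subst emeasure_distr) (auto simp: vimage_def)
  also have "\<dots> = emeasure lborel ({0..1} \<inter> ?B)"
    unfolding distr_bin_real using B by (simp add: divide_ennreal_def)
  also have "{0..1} \<inter> ?B = (+) c -` (A \<inter> {c..c + 1})" by auto
  also have "emeasure lborel \<dots> = emeasure (distr lborel borel ((+) c)) (A \<inter> {c..c + 1})"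
    by (subst emeasure_distr) auto
  also have "distr lborel borel ((+) c) = lborel" by (rule lborel_distr_plus)
  finally show ?thesis .
qed

lemma emeasure_lborel_pos_unit_interval:
  assumes A: "A \<in> sets borel" "0 < emeasure lborel A"
  shows "\<exists>z::int. 0 < emeasure lborel (A \<inter> {real_of_int z..real_of_int z + 1})"
proof (rule ccontr)
  assume "\<not> ?thesis"
  then have 0: "emeasure lborel (A \<inter> {real_of_int z..real_of_int z + 1}) = 0" for z
    by (simp add: not_gr_zero)
  have "A \<subseteq> (\<Union>z. A \<inter> {real_of_int z..real_of_int z + 1})"
  proof
    fix x assume "x \<in> A"
    then have "x \<in> A \<inter> {real_of_int \<lfloor>x\<rfloor>..real_of_int \<lfloor>x\<rfloor> + 1}" by simp
    then show "x \<in> (\<Union>z. A \<inter> {real_of_int z..real_of_int z + 1})" by blast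
  qed
  moreover have "(\<Union>z. A \<inter> {real_of_int z..real_of_int z + 1}) \<in> null_sets lborel"
    using A 0 by (intro null_sets_UN') auto
  ultimately have "emeasure lborel A = 0"
    using A(1) by (metis null_setsD1 null_sets_subset sets_lborel)
  then show False using A(2) by simp
qed

text \<open>Otherwise infinitely many essentially disjoint pieces of \<open>U\<close> would each
  have measure at least \<open>c\<close>. In the application \<open>U\<close> is what is removed
  around the rationals and \<open>g k\<close> is the place of the \<open>k\<close>-th copy of a
  column.\<close>

lemma emeasure_finite_tail:
  fixes g :: "nat \<Rightarrow> nat"
  assumes U: "U \<in> sets borel" "emeasure lborel U < \<infinity>" and c: "0 < c" and inj: "inj g"
  shows "\<exists>k. emeasure lborel (U \<inter> {real (g k)..real (g k) + 1}) < c"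
proof (rule ccontr)
  assume "\<not> ?thesis"
  then have *: "c \<le> emeasure lborel (U \<inter> {real (g k)..real (g k) + 1})" for k
    by (simp add: not_less)
  \<comment> \<open>Closed unit intervals at consecutive integers share an endpoint; half-open ones
    are disjoint and differ from them by a null set.\<close>
  have half: "emeasure lborel (U \<inter> {real m..real m + 1}) = emeasure lborel (U \<inter> {real m..<real m + 1})" for m
  proof (rule emeasure_eq_AE)
    have "AE x in lborel. x \<noteq> real m + 1" by (rule AE_lborel_singleton)
    then show "AE x in lborel. x \<in> U \<inter> {real m..real m + 1} \<longleftrightarrow> x \<in> U \<inter> {real m..<real m + 1}"
      by eventually_elim auto
  qed (use U in auto)
  have "(\<Sum>k. emeasure lborel (U \<inter> {real (g k)..<real (g k) + 1}))
      = emeasure lborel (\<Union>k. U \<inter> {real (g k)..<real (g k) + 1})"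
  proof (rule suminf_emeasure)
    show "disjoint_family (\<lambda>k. U \<inter> {real (g k)..<real (g k) + 1})"
      unfolding disjoint_family_on_def
    proof (intro ballI impI)
      fix m n assume "m \<noteq> (n :: nat)"
      then have "g m \<noteq> g n" using inj by (simp add: inj_eq)
      then have "g m + 1 \<le> g n \<or> g n + 1 \<le> g m" by linarith
      then have "real (g m) + 1 \<le> real (g n) \<or> real (g n) + 1 \<le> real (g m)" by linarith
      then show "(U \<inter> {real (g m)..<real (g m) + 1}) \<inter> (U \<inter> {real (g n)..<real (g n) + 1}) = {}" by auto
    qed
  qed (use U in auto)
  also have "\<dots> \<le> emeasure lborel U" using U by (intro emeasure_mono) auto
  finally have le: "(\<Sum>k. emeasure lborel (U \<inter> {real (g k)..<real (g k) + 1})) < \<infinity>"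
    using U(2) by (rule le_less_trans)
  have "of_nat n * c \<le> (\<Sum>k. emeasure lborel (U \<inter> {real (g k)..<real (g k) + 1}))" for n
  proof -
    have "of_nat n * c = (\<Sum>k<n. c)" by simp
    also have "\<dots> \<le> (\<Sum>k<n. emeasure lborel (U \<inter> {real (g k)..<real (g k) + 1}))"
      using * half by (intro sum_mono) simp
    also have "\<dots> \<le> (\<Sum>k. emeasure lborel (U \<inter> {real (g k)..<real (g k) + 1}))"
      by (rule sum_le_suminf) auto
    finally show ?thesis .
  qed
  then have "(SUP n. of_nat n * c) \<le> (\<Sum>k. emeasure lborel (U \<inter> {real (g k)..<real (g k) + 1}))"
    by (rule SUP_least)
  moreover have "(SUP n. of_nat n * c) = \<top>"
    using c by (simp add: SUP_mult_right_ennreal[symmetric] ennreal_SUP_of_nat_eq_top ennreal_top_mult)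
  ultimately show False using le by (simp add: top_unique)
qed

section \<open>The discrete jumps\<close>

text \<open>\<open>u\<close> bounds the part of the input that a digit depends on; the machine waits
  for that much and then answers.\<close>

lemma computes_finite_use:
  assumes "\<And>n k. u n \<le> k \<Longrightarrow> f (query n p k) = q n"
  shows "computes (\<lambda>x. of_bool (u (\<pi>1 x) \<le> code_length (\<pi>2 x)) * Suc (f x)) p q"
  by (rule computesI) (use assms in auto)

lemma rep_negI:
  assumes "\<And>x. x \<notin> A \<longleftrightarrow> (\<exists>i. 0 < p i \<and> x \<in> bas (p i - 1))"
  shows "rep_neg bas p A"
  unfolding rep_neg_def using assms by blast

lemma rep_neg_iff: "rep_neg bas p A \<Longrightarrow> x \<notin> A \<longleftrightarrow> (\<exists>i. 0 < p i \<and> x \<in> bas (p i - 1))"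
  unfolding rep_neg_def by blast

lemma djump_simps [simp]:
  "inrep (djump f) p x \<longleftrightarrow> (\<exists>q. lim_Delta p q \<and> inrep f q x)"
  "outrep (djump f) = outrep f" "pdom (djump f) = pdom f" "prel (djump f) = prel f"
  by (simp_all add: djump_def)

lemma PC_simps [simp]:
  "inrep (PC bas rep M) = rep_neg bas" "outrep (PC bas rep M) = rep"
  "A \<in> pdom (PC bas rep M) \<longleftrightarrow> 0 < emeasure M A" "prel (PC bas rep M) A = A"
  by (simp_all add: PC_def)

lemma WWKL_simps [simp]:
  "inrep WWKL = rep_tree" "outrep WWKL = rep_cantor"
  "T \<in> pdom WWKL \<longleftrightarrow> 0 < emeasure cantor_measure (paths T)" "prel WWKL T = paths T"
  by (simp_all add: WWKL_def)

lemma paths_rep_neg: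
  assumes "\<And>n. q n = of_bool (bl_of_nat n \<in> T)"
  shows "rep_neg bas_cantor (\<lambda>n. if q n = 0 then Suc n else 0) (paths T)"
proof (rule rep_negI)
  fix x
  have "x \<notin> paths T \<longleftrightarrow> (\<exists>n. map x [0..<n] \<notin> T)" by (simp add: paths_def)
  also have "\<dots> \<longleftrightarrow> (\<exists>w. w \<notin> T \<and> x \<in> cyl w)"
    unfolding cyl_def by (metis (mono_tags) length_map length_upt mem_Collect_eq diff_zero)
  also have "\<dots> \<longleftrightarrow> (\<exists>n. bl_of_nat n \<notin> T \<and> x \<in> cyl (bl_of_nat n))"
    using bij_bl_of_nat by (metis bij_pointE)
  finally show "x \<notin> paths T \<longleftrightarrow> (\<exists>i. 0 < (if q i = 0 then Suc i else 0) \<and>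
      x \<in> bas_cantor ((if q i = 0 then Suc i else 0) - 1))"
    by (auto simp: assms bas_cantor_def)
qed

text \<open>A point leaves \<open>paths T\<close> exactly at a prefix outside \<open>T\<close>, so
  the cylinders of all words outside \<open>T\<close> can be listed digit by digit. This acts on
  every component separately and hence commutes with the limit: \<open>\<pi>2 (\<pi>1 x)\<close> is
  the position inside the component, and \<open>?H\<close> copies the answer.\<close>

lemma WWKL_le_PC_cantor: "sW_le (djump WWKL) (djump PC_cantor)"
proof (rule sW_leI)
  let ?H = "\<lambda>x. of_bool (Suc (\<pi>1 x) \<le> code_length (\<pi>2 x)) * Suc (code_nth (\<pi>2 x) (\<pi>1 x))"
  let ?K = "\<lambda>x. of_bool (Suc (\<pi>1 x) \<le> code_length (\<pi>2 x)) *
    Suc (if code_nth (\<pi>2 x) (\<pi>1 x) = 0 then Suc (\<pi>2 (\<pi>1 x)) else 0)"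
  show "total_computable ?H" "total_computable ?K" by (intro tc_intros)+
  fix p T assume "inrep (djump WWKL) p T" and dom: "T \<in> pdom (djump WWKL)"
  then obtain q N where N: "\<forall>i\<ge>N. (\<lambda>j. p (prod_encode (i, j))) = q" and q: "rep_tree q T"
    by (auto simp: lim_Delta_def)
  let ?p' = "\<lambda>n. if p n = 0 then Suc (\<pi>2 n) else 0" and ?q' = "\<lambda>n. if q n = 0 then Suc n else 0"
  have "computes ?K p ?p'" by (rule computes_finite_use) (simp add: code_nth_prefix)
  moreover have "lim_Delta ?p' ?q'"
    unfolding lim_Delta_def using N by (intro exI[of _ N]) (auto simp: fun_eq_iff)
  moreover have "rep_neg bas_cantor ?q' (paths T)"
    using q by (intro paths_rep_neg) (simp add: rep_tree_def)
  moreover have "computes ?H r r" for r by (rule computes_finite_use) (simp add: code_nth_prefix)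
  ultimately show "\<exists>p' x'. computes ?K p p' \<and> inrep (djump PC_cantor) p' x' \<and> x' \<in> pdom (djump PC_cantor) \<and>
      (\<forall>q y. outrep (djump PC_cantor) q y \<longrightarrow> y \<in> prel (djump PC_cantor) x' \<longrightarrow>
        (\<exists>q' y'. computes ?H q q' \<and> outrep (djump WWKL) q' y' \<and> y' \<in> prel (djump WWKL) T))"
    using dom by (intro exI[of _ ?p'] exI[of _ "paths T"]) (auto simp: PC_cantor_def)
qed

lemma PC_cantor_le_PC_natcantor: "sW_le (djump PC_cantor) PC_natcantor"
proof (rule sW_leI)
  let ?H = "\<lambda>x. of_bool (Suc (Suc (\<pi>1 x)) \<le> code_length (\<pi>2 x)) * Suc (code_nth (\<pi>2 x) (Suc (\<pi>1 x)))"
  define u where "u s = Suc (prod_encode (\<pi>1 s, \<pi>2 (\<pi>2 s)) + prod_encode (\<pi>1 s + \<pi>1 (\<pi>2 s), \<pi>2 (\<pi>2 s)))" for s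
  \<comment> \<open>Read \<open>s\<close> as \<open>(m, (c, e))\<close>. For \<open>c = 0\<close>,
    entry \<open>e\<close> of component \<open>m\<close> is copied into column \<open>m\<close>. For
    \<open>c > 0\<close>, components \<open>m\<close> and \<open>m + c\<close> are compared at
    \<open>e\<close>; a difference lists the pair \<open>(m, 0)\<close>, which is all of column
    \<open>m\<close> because 0 codes the empty word.\<close>
  define out where "out P s =
     (if \<pi>1 (\<pi>2 s) = 0
      then if P (prod_encode (\<pi>1 s, \<pi>2 (\<pi>2 s))) = 0 then 0
           else Suc (prod_encode (\<pi>1 s, P (prod_encode (\<pi>1 s, \<pi>2 (\<pi>2 s))) - 1))
      else if P (prod_encode (\<pi>1 s + \<pi>1 (\<pi>2 s), \<pi>2 (\<pi>2 s))) = P (prod_encode (\<pi>1 s, \<pi>2 (\<pi>2 s))) then 0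
           else Suc (prod_encode (\<pi>1 s, 0)))" for P :: baire and s
  let ?K = "\<lambda>x. of_bool (u (\<pi>1 x) \<le> code_length (\<pi>2 x)) * Suc (out (code_nth (\<pi>2 x)) (\<pi>1 x))"
  show "total_computable ?H" by (intro tc_intros)+
  show "total_computable ?K" unfolding u_def out_def by (intro tc_intros)
  fix p A assume "inrep (djump PC_cantor) p A" and "A \<in> pdom (djump PC_cantor)"
  then obtain q N where N: "\<And>i. i \<ge> N \<Longrightarrow> (\<lambda>j. p (prod_encode (i, j))) = q" and q: "rep_neg bas_cantor q A"
    and pos: "0 < emeasure cantor_measure A"
    by (auto simp: lim_Delta_def PC_cantor_def)
  \<comment> \<open>A column survives only if the sequence is constant from its index on; then its
    component is the limit and names \<open>A\<close>. So a solution from any column is correct, and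
    \<open>?H\<close> may drop the column number.\<close>
  define B where "B = {(m, x). (\<forall>i\<ge>m. \<forall>e. p (prod_encode (i, e)) = p (prod_encode (m, e))) \<and> x \<in> A}"
  have "computes ?K p (out p)"
    by (rule computes_finite_use[where f = "\<lambda>x. out (code_nth (\<pi>2 x)) (\<pi>1 x)"])
       (simp add: u_def out_def code_nth_prefix)
  moreover have rep: "rep_neg bas_natcantor (out p) B"
  proof (rule rep_negI)
    fix z :: "nat \<times> (nat \<Rightarrow> bool)"
    obtain m x where z: "z = (m, x)" by force
    let ?R = "\<exists>s. 0 < out p s \<and> z \<in> bas_natcantor (out p s - 1)"
    show "z \<notin> B \<longleftrightarrow> ?R"
    proof (cases "\<forall>i\<ge>m. \<forall>e. p (prod_encode (i, e)) = p (prod_encode (m, e))")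
      case True
      have "p (prod_encode (m, e)) = q e" for e
        using True N[of "max m N"] by (metis max.cobounded1 max.cobounded2)
      then have pm: "(\<lambda>e. p (prod_encode (m, e))) = q" by auto
      have "z \<notin> B \<longleftrightarrow> x \<notin> A" using True unfolding z B_def by blast
      also have "\<dots> \<longleftrightarrow> (\<exists>e. 0 < q e \<and> x \<in> cyl (bl_of_nat (q e - 1)))"
        using rep_neg_iff[OF q] by (simp add: bas_cantor_def)
      also have "\<dots> \<longleftrightarrow> ?R"
      proof
        assume "\<exists>e. 0 < q e \<and> x \<in> cyl (bl_of_nat (q e - 1))"
        then obtain e where "0 < p (prod_encode (m, e))" "x \<in> cyl (bl_of_nat (p (prod_encode (m, e)) - 1))"
          unfolding pm[symmetric] by blast
        then show ?R
          by (intro exI[of _ "prod_encode (m, prod_encode (0, e))"]) (simp add: out_def bas_natcantor_def z)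
      next
        assume ?R
        then obtain s where s: "0 < out p s" "z \<in> bas_natcantor (out p s - 1)" by blast
        then have m: "\<pi>1 s = m" by (auto simp: out_def bas_natcantor_def z split: if_splits)
        have "p (prod_encode (m + c, e)) = p (prod_encode (m, e))" for c e
          using True le_add1 by blast
        then show "\<exists>e. 0 < q e \<and> x \<in> cyl (bl_of_nat (q e - 1))"
          using s unfolding pm[symmetric] m[symmetric]
          by (intro exI[of _ "\<pi>2 (\<pi>2 s)"]) (auto simp: out_def bas_natcantor_def z split: if_splits)
      qed
      finally show ?thesis .
    next
      case False
      then obtain i e where "m \<le> i" and ne: "p (prod_encode (i, e)) \<noteq> p (prod_encode (m, e))" by blast
      then obtain c where c: "i = m + c" "c \<noteq> 0" by (metis le_Suc_ex add_0_right)
      have "z \<notin> B" using False unfolding z B_def by blast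
      moreover have ?R
        using ne c by (intro exI[of _ "prod_encode (m, prod_encode (c, e))"])
          (simp add: out_def bas_natcantor_def z cyl_def)
      ultimately show ?thesis by blast
    qed
  qed
  moreover have "0 < emeasure natcantor_measure B"
  proof -
    have "Pair N -` B = A" using N by (auto simp: B_def fun_eq_iff)
    moreover have "B \<in> sets natcantor_measure"
      using rep_neg_measurable[OF rep bas_natcantor_measurable space_natcantor] .
    ultimately show ?thesis using pos emeasure_natcantor_pos_iff by metis
  qed
  moreover have "computes ?H r (\<lambda>n. r (Suc n))" for r
    by (rule computes_finite_use) (simp add: code_nth_prefix)
  moreover have "rep_cantor (\<lambda>n. r (Suc n)) (snd z)" "snd z \<in> A" if "rep_natcantor r z" "z \<in> B" for r z
    using that by (auto simp: rep_natcantor_def rep_cantor_def B_def)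
  ultimately show "\<exists>p' x'. computes ?K p p' \<and> inrep PC_natcantor p' x' \<and> x' \<in> pdom PC_natcantor \<and>
      (\<forall>q y. outrep PC_natcantor q y \<longrightarrow> y \<in> prel PC_natcantor x' \<longrightarrow>
        (\<exists>q' y'. computes ?H q q' \<and> outrep (djump PC_cantor) q' y' \<and> y' \<in> prel (djump PC_cantor) A))"
    unfolding PC_cantor_def PC_natcantor_def djump_simps PC_simps by blast
qed

text \<open>The tree of the sequences \<open>0^n 1 x\<close> with \<open>x\<close> in column
  \<open>n\<close> of the set named by \<open>p\<close>. A word consults only entries
  \<open>p j\<close> with \<open>j < length w\<close>, and only cylinders that it is long enough to
  enter. This makes membership decidable and lets conditions only accumulate as the word
  grows.\<close>

definition column_tree :: "baire \<Rightarrow> nat \<Rightarrow> bool list set" where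
  "column_tree p n = {w. (\<forall>i<length w. (i < n \<longrightarrow> \<not> w ! i) \<and> (i = n \<longrightarrow> w ! i)) \<and>
     (\<forall>j<length w. p j \<noteq> 0 \<longrightarrow> \<pi>1 (p j - 1) = n \<longrightarrow>
        Suc n + length (bl_of_nat (\<pi>2 (p j - 1))) \<le> length w \<longrightarrow>
        \<not> (\<forall>i<length (bl_of_nat (\<pi>2 (p j - 1))). w ! (Suc n + i) = bl_of_nat (\<pi>2 (p j - 1)) ! i))}"

text \<open>The same condition on codes of words, with bounded quantifiers and arithmetic only, so
  that the computability rules apply.\<close>

definition in_column_tree :: "baire \<Rightarrow> nat \<Rightarrow> nat \<Rightarrow> bool" where
  "in_column_tree p n c \<longleftrightarrow>
     (\<forall>i<length (bl_of_nat c). (i < n \<longrightarrow> \<not> word_bit c i) \<and> (i = n \<longrightarrow> word_bit c i)) \<and>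
     (\<forall>j<length (bl_of_nat c). p j \<noteq> 0 \<longrightarrow> \<pi>1 (p j - 1) = n \<longrightarrow>
        Suc n + length (bl_of_nat (\<pi>2 (p j - 1))) \<le> length (bl_of_nat c) \<longrightarrow>
        \<not> (\<forall>i<length (bl_of_nat (\<pi>2 (p j - 1))). word_bit c (Suc n + i) = word_bit (\<pi>2 (p j - 1)) i))"

lemma in_column_tree_iff: "in_column_tree p n c \<longleftrightarrow> bl_of_nat c \<in> column_tree p n"
  unfolding in_column_tree_def column_tree_def word_bit_eq by auto

lemma in_column_tree_cong:
  assumes "\<And>j. j < length (bl_of_nat c) \<Longrightarrow> p j = q j"
  shows "in_column_tree p n c \<longleftrightarrow> in_column_tree q n c"
  unfolding in_column_tree_def using assms by auto

lemma tcb_in_column_tree [tc_intros]: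
  assumes "total_computable l" "total_computable n" "total_computable c"
  shows "tcb (\<lambda>x. in_column_tree (code_nth (l x)) (n x) (c x))"
  unfolding in_column_tree_def
  by (intro tc_intros assms tc_comp[OF assms(1)] tc_comp[OF assms(2)] tc_comp[OF assms(3)])

lemma column_treeI:
  assumes "\<And>i. i < length w \<Longrightarrow> (i < n \<longrightarrow> \<not> w ! i) \<and> (i = n \<longrightarrow> w ! i)"
    and "\<And>j. j < length w \<Longrightarrow> p j \<noteq> 0 \<Longrightarrow> \<pi>1 (p j - 1) = n \<Longrightarrow>
      Suc n + length (bl_of_nat (\<pi>2 (p j - 1))) \<le> length w \<Longrightarrow>
      \<forall>i<length (bl_of_nat (\<pi>2 (p j - 1))). w ! (Suc n + i) = bl_of_nat (\<pi>2 (p j - 1)) ! i \<Longrightarrow> False"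
  shows "w \<in> column_tree p n"
  using assms unfolding column_tree_def by blast

lemma is_tree_column_tree: "is_tree (column_tree p n)"
  unfolding is_tree_def
proof (intro allI impI)
  fix u v assume uv: "u @ v \<in> column_tree p n"
  show "u \<in> column_tree p n"
  proof (rule column_treeI)
    show "(i < n \<longrightarrow> \<not> u ! i) \<and> (i = n \<longrightarrow> u ! i)" if "i < length u" for i
    proof -
      have "i < length (u @ v)" using that by simp
      then have "(i < n \<longrightarrow> \<not> (u @ v) ! i) \<and> (i = n \<longrightarrow> (u @ v) ! i)"
        using uv unfolding column_tree_def by blast
      then show ?thesis using that by (simp add: nth_append)
    qed
    fix j assume j: "j < length u" "p j \<noteq> 0" "\<pi>1 (p j - 1) = n"
      and le: "Suc n + length (bl_of_nat (\<pi>2 (p j - 1))) \<le> length u"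
      and eq: "\<forall>i<length (bl_of_nat (\<pi>2 (p j - 1))). u ! (Suc n + i) = bl_of_nat (\<pi>2 (p j - 1)) ! i"
    have "j < length (u @ v)" "Suc n + length (bl_of_nat (\<pi>2 (p j - 1))) \<le> length (u @ v)"
      using j le by auto
    moreover have "\<forall>i<length (bl_of_nat (\<pi>2 (p j - 1))). (u @ v) ! (Suc n + i) = bl_of_nat (\<pi>2 (p j - 1)) ! i"
      using eq le by (auto simp: nth_append)
    ultimately show False using uv j(2,3) unfolding column_tree_def by blast
  qed
qed

lemma paths_column_tree:
  assumes "rep_neg bas_natcantor p A"
  shows "y \<in> paths (column_tree p n) \<longleftrightarrow> (\<forall>i<n. \<not> y i) \<and> y n \<and> (n, \<lambda>i. y (Suc n + i)) \<in> A"
proof -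
  let ?x = "\<lambda>i. y (Suc n + i)"
  let ?b = "\<lambda>j. bl_of_nat (\<pi>2 (p j - 1))"
  have A: "(n, ?x) \<notin> A \<longleftrightarrow> (\<exists>j. p j \<noteq> 0 \<and> \<pi>1 (p j - 1) = n \<and> ?x \<in> cyl (?b j))"
    unfolding rep_neg_iff[OF assms] bas_natcantor_def by (auto simp: case_prod_beta)
  have "y \<in> paths (column_tree p n) \<longleftrightarrow> (\<forall>k. map y [0..<k] \<in> column_tree p n)"
    by (simp add: paths_def)
  also have "\<dots> \<longleftrightarrow> (\<forall>i. (i < n \<longrightarrow> \<not> y i) \<and> (i = n \<longrightarrow> y i)) \<and>
      (\<forall>j. p j \<noteq> 0 \<longrightarrow> \<pi>1 (p j - 1) = n \<longrightarrow> ?x \<notin> cyl (?b j))" (is "?L \<longleftrightarrow> ?R1 \<and> ?R2")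
  proof
    assume L: ?L
    show "?R1 \<and> ?R2"
    proof (intro conjI)
      have "(i < n \<longrightarrow> \<not> y i) \<and> (i = n \<longrightarrow> y i)" for i
      proof -
        have "map y [0..<Suc i] \<in> column_tree p n" using L by blast
        then have "(i < n \<longrightarrow> \<not> map y [0..<Suc i] ! i) \<and> (i = n \<longrightarrow> map y [0..<Suc i] ! i)"
          unfolding column_tree_def by (auto simp del: upt_Suc)
        then show ?thesis by (simp del: upt_Suc)
      qed
      then show ?R1 by blast
      show ?R2
      proof (intro allI impI notI)
        fix j assume j: "p j \<noteq> 0" "\<pi>1 (p j - 1) = n" "?x \<in> cyl (?b j)"
        \<comment> \<open>Long enough both to contain the listed cylinder behind
          \<open>0^n 1\<close> and to have consulted entry \<open>j\<close>.\<close>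
        let ?k = "Suc n + length (?b j) + Suc j"
        have "map y [0..<?k] \<in> column_tree p n" using L by blast
        moreover have "j < length (map y [0..<?k])" "Suc n + length (?b j) \<le> length (map y [0..<?k])"
          by simp_all
        moreover have "\<forall>i<length (?b j). map y [0..<?k] ! (Suc n + i) = ?b j ! i"
          using j(3) by (simp add: mem_cyl_iff del: upt_Suc)
        ultimately show False using j(1,2) unfolding column_tree_def by blast
      qed
    qed
  next
    assume R: "?R1 \<and> ?R2"
    show ?L
    proof (intro allI column_treeI)
      fix k
      show "(i < n \<longrightarrow> \<not> map y [0..<k] ! i) \<and> (i = n \<longrightarrow> map y [0..<k] ! i)"
        if "i < length (map y [0..<k])" for i
        using R that by simp
      fix j assume j: "p j \<noteq> 0" "\<pi>1 (p j - 1) = n"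
        and le: "Suc n + length (?b j) \<le> length (map y [0..<k])"
        and eq: "\<forall>i<length (?b j). map y [0..<k] ! (Suc n + i) = ?b j ! i"
      have "?x \<in> cyl (?b j)" using le eq by (simp add: mem_cyl_iff)
      then show False using R j by blast
    qed
  qed
  also have "?R1 \<and> ?R2 \<longleftrightarrow> (\<forall>i<n. \<not> y i) \<and> y n \<and> (n, ?x) \<in> A"
    using A by blast
  finally show ?thesis .
qed

definition level_count :: "baire \<Rightarrow> nat \<Rightarrow> nat \<Rightarrow> nat" where
  "level_count p n i = (\<Sum>c<2 ^ Suc i. of_bool (length (bl_of_nat c) = i \<and> in_column_tree p n c))"

lemma level_count_eq: "level_count p n i = card {w \<in> column_tree p n. length w = i}"
proof -
  have "level_count p n i = card ({c. length (bl_of_nat c) = i \<and> in_column_tree p n c} \<inter> {..<2 ^ Suc i})"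
    by (simp add: level_count_def Int_commute)
  also have "{c. length (bl_of_nat c) = i \<and> in_column_tree p n c} \<inter> {..<2 ^ Suc i} =
      {c. length (bl_of_nat c) = i \<and> in_column_tree p n c}"
  proof -
    have "c < 2 ^ Suc i" if "length (bl_of_nat c) = i" for c
      using length_bl_of_nat_bounds(2)[of c] that by simp
    then show ?thesis by auto
  qed
  also have "card \<dots> = card (bl_of_nat ` \<dots>)"
    using bij_bl_of_nat by (intro card_image[symmetric]) (auto simp: bij_def inj_on_def)
  also have "bl_of_nat ` {c. length (bl_of_nat c) = i \<and> in_column_tree p n c} = {w \<in> column_tree p n. length w = i}"
    using bij_bl_of_nat by (auto simp: in_column_tree_iff image_iff) (metis bij_pointE)
  finally show ?thesis .
qed

text \<open>The index \<open>m\<close> codes the claim that the tree of column \<open>\<pi>1 m\<close> has measure at least \<open>2 ^ - \<pi>2 m\<close>;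
  the candidate of stage \<open>i\<close> is the least claim not refuted at level \<open>i\<close>.\<close>

definition candidate :: "baire \<Rightarrow> nat \<Rightarrow> nat" where
  "candidate p i = (LEAST m. m = i \<or> 2 ^ i \<le> level_count p (\<pi>1 m) i * 2 ^ \<pi>2 m)"

lemma level_count_cong:
  assumes "\<And>j. j < i \<Longrightarrow> p j = q j"
  shows "level_count p n i = level_count q n i"
  unfolding level_count_def using in_column_tree_cong[of _ p q] assms by (intro sum.cong) auto

lemma candidate_cong:
  assumes "\<And>j. j < i \<Longrightarrow> p j = q j"
  shows "candidate p i = candidate q i"
  unfolding candidate_def using level_count_cong[of i p q] assms by simp

lemma tc_candidate [tc_intros]:
  assumes "total_computable l" "total_computable i"
  shows "total_computable (\<lambda>x. candidate (code_nth (l x)) (i x))"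
  unfolding candidate_def level_count_def
  by (intro tc_intros assms tc_comp[OF assms(1)] tc_comp[OF assms(2)])

text \<open>The least true claim is never refuted, since each level bounds the measure of the paths
  from above. The finitely many claims before it are false, and each is refuted at all sufficiently
  large levels because the level measures converge. The integer test is the comparison with
  \<open>(1 / 2) ^ k\<close> after clearing denominators.\<close>

lemma candidate_converges:
  assumes "0 < measure cantor_measure (paths (column_tree p n0))"
  shows "\<exists>m. 0 < measure cantor_measure (paths (column_tree p (\<pi>1 m))) \<and> (\<exists>N. \<forall>i\<ge>N. candidate p i = m)"
proof -
  let ?\<mu> = "\<lambda>n. measure cantor_measure (paths (column_tree p n))"
  let ?P = "\<lambda>m. (1 / 2) ^ \<pi>2 m \<le> ?\<mu> (\<pi>1 m)"
  define m where "m = (LEAST m. ?P m)"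
  obtain k where "(1 / 2 :: real) ^ k < ?\<mu> n0"
    using real_arch_pow_inv[OF assms, of "1 / 2"] by auto
  then have "?P (prod_encode (n0, k))" by simp
  then have m: "?P m" unfolding m_def by (rule LeastI)
  have less: "\<not> ?P m'" if "m' < m" for m' using not_less_Least that unfolding m_def by blast
  have iff: "2 ^ i \<le> level_count p n i * 2 ^ k \<longleftrightarrow>
      (1 / 2) ^ k \<le> card {w \<in> column_tree p n. length w = i} * (1 / 2 :: real) ^ i" for i n k
  proof -
    have "2 ^ i \<le> level_count p n i * 2 ^ k \<longleftrightarrow> real (2 ^ i) \<le> real (level_count p n i * 2 ^ k)"
      by (simp only: of_nat_le_iff)
    also have "\<dots> \<longleftrightarrow> (1 / 2) ^ k \<le> card {w \<in> column_tree p n. length w = i} * (1 / 2 :: real) ^ i"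
      by (simp add: level_count_eq field_simps power_divide)
    finally show ?thesis .
  qed
  have "\<forall>m'\<in>{..<m}. eventually (\<lambda>i. \<not> 2 ^ i \<le> level_count p (\<pi>1 m') i * 2 ^ \<pi>2 m') sequentially"
  proof
    fix m' assume "m' \<in> {..<m}"
    then have "?\<mu> (\<pi>1 m') < (1 / 2) ^ \<pi>2 m'" using less[of m'] by auto
    from order_tendstoD(2)[OF measure_paths_limit[OF is_tree_column_tree] this]
    show "eventually (\<lambda>i. \<not> 2 ^ i \<le> level_count p (\<pi>1 m') i * 2 ^ \<pi>2 m') sequentially"
      unfolding iff not_le .
  qed
  then have "eventually (\<lambda>i. \<forall>m'\<in>{..<m}. \<not> 2 ^ i \<le> level_count p (\<pi>1 m') i * 2 ^ \<pi>2 m') sequentially"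
    by (intro eventually_ball_finite) auto
  then obtain N where N: "\<And>i m'. i \<ge> N \<Longrightarrow> m' < m \<Longrightarrow> \<not> 2 ^ i \<le> level_count p (\<pi>1 m') i * 2 ^ \<pi>2 m'"
    unfolding eventually_sequentially by auto
  \<comment> \<open>From \<open>m\<close> on, the default \<open>i\<close> of the bounded search can
    no longer undercut \<open>m\<close>.\<close>
  have "candidate p i = m" if "i \<ge> max N m" for i
    unfolding candidate_def
  proof (rule Least_equality)
    show "m = i \<or> 2 ^ i \<le> level_count p (\<pi>1 m) i * 2 ^ \<pi>2 m"
      unfolding iff using m measure_paths_le[of "column_tree p (\<pi>1 m)" i] by linarith
    show "m \<le> m'" if "m' = i \<or> 2 ^ i \<le> level_count p (\<pi>1 m') i * 2 ^ \<pi>2 m'" for m'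
      using that N[of i m'] \<open>i \<ge> max N m\<close> by (metis max.bounded_iff not_le)
  qed
  moreover have "0 < ?\<mu> (\<pi>1 m)"
  proof -
    have "0 < (1 / 2 :: real) ^ \<pi>2 m" by simp
    then show ?thesis using m by linarith
  qed
  ultimately show ?thesis by blast
qed

lemma PC_natcantor_le_WWKL: "sW_le PC_natcantor (djump WWKL)"
proof (rule sW_leI)
  define start where "start l = (LEAST i. i = code_length l \<or> code_nth l i \<noteq> 0)" for l
  \<comment> \<open>\<open>start\<close> is the position of the first 1, or the length of the prefix
    if none has been read; in the latter case this test fails.\<close>
  let ?P = "\<lambda>x. start (\<pi>2 x) + \<pi>1 x < code_length (\<pi>2 x)"
  \<comment> \<open>Digit 0 is the column \<open>n\<close>. Digit \<open>s > 0\<close> of the pair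
    is bit \<open>s - 1\<close> of the second part, which stands at position \<open>n + s\<close> of
    the path.\<close>
  let ?f = "\<lambda>x. if \<pi>1 x = 0 then start (\<pi>2 x) else code_nth (\<pi>2 x) (start (\<pi>2 x) + \<pi>1 x)"
  let ?H = "\<lambda>x. of_bool (?P x) * Suc (?f x)"
  let ?out = "\<lambda>p s. of_bool (in_column_tree p (\<pi>1 (candidate p (\<pi>1 s))) (\<pi>2 s)) :: nat"
  \<comment> \<open>At \<open>s = (i, c)\<close> the word \<open>c\<close> is tested in the tree of
    the candidate column of stage \<open>i\<close>. The first \<open>s\<close> entries of
    \<open>p\<close> suffice: the stage \<open>i\<close> and the length of word \<open>c\<close> are
    both at most \<open>s\<close>.\<close>
  let ?K = "\<lambda>x. of_bool (\<pi>1 x \<le> code_length (\<pi>2 x)) * Suc (?out (code_nth (\<pi>2 x)) (\<pi>1 x))"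
  have start: "total_computable (\<lambda>x. start (f x))" if "total_computable f" for f
    unfolding start_def by (intro tc_intros that tc_comp[OF that])
  show "total_computable ?H" by (intro tc_intros start)
  show "total_computable ?K" by (intro tc_intros)
  fix p A assume "inrep PC_natcantor p A" and "A \<in> pdom PC_natcantor"
  then have p: "rep_neg bas_natcantor p A" and pos: "0 < emeasure natcantor_measure A"
    by (auto simp: PC_natcantor_def)
  have A: "A \<in> sets natcantor_measure"
    using rep_neg_measurable[OF p bas_natcantor_measurable space_natcantor] .
  then obtain n0 where n0: "0 < emeasure cantor_measure (Pair n0 -` A)"
    using pos emeasure_natcantor_pos_iff by blast
  let ?w = "replicate n0 False @ [True]"
  have "0 < emeasure cantor_measure (paths (column_tree p n0))"
  proof (rule measure_prepend_pos[OF section_measurable[OF A] n0 paths_measurable])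
    fix x assume x: "x \<in> Pair n0 -` A"
    show "comb_seq (length ?w) ((!) ?w) x \<in> paths (column_tree p n0)"
      unfolding paths_column_tree[OF p] using x by (auto simp: comb_seq_def nth_append)
  qed
  then have "0 < measure cantor_measure (paths (column_tree p n0))"
    by (simp add: cantor.emeasure_eq_measure)
  then obtain m N where N: "\<And>i. i \<ge> N \<Longrightarrow> candidate p i = m"
    and m: "0 < measure cantor_measure (paths (column_tree p (\<pi>1 m)))"
    using candidate_converges by blast
  define n where "n = \<pi>1 m"
  have "computes ?K p (?out p)"
  proof (rule computes_finite_use[where f = "\<lambda>x. ?out (code_nth (\<pi>2 x)) (\<pi>1 x)"])
    fix s k :: nat assume "s \<le> k"
    let ?c = "code_nth (list_encode (map p [0..<k]))"
    have c: "?c j = p j" if "j < s" for j using that \<open>s \<le> k\<close> by (simp add: code_nth_prefix)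
    have le: "\<pi>1 s \<le> s" "\<pi>2 s \<le> s"
      using le_prod_encode_1[of "\<pi>1 s" "\<pi>2 s"] le_prod_encode_2[of "\<pi>2 s" "\<pi>1 s"] by simp_all
    have "candidate ?c (\<pi>1 s) = candidate p (\<pi>1 s)"
      by (rule candidate_cong) (use c le in simp)
    moreover have "in_column_tree ?c n' (\<pi>2 s) = in_column_tree p n' (\<pi>2 s)" for n'
      by (rule in_column_tree_cong) (use c le length_bl_of_nat_le[of "\<pi>2 s"] in simp)
    ultimately show "?out (code_nth (\<pi>2 (query s p k))) (\<pi>1 (query s p k)) = ?out p s"
      by simp
  qed
  moreover have "inrep (djump WWKL) (?out p) (column_tree p n)"
  proof -
    have "lim_Delta (?out p) (\<lambda>c. of_bool (in_column_tree p n c))"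
      unfolding lim_Delta_def using N by (intro exI[of _ N]) (auto simp: n_def)
    moreover have "rep_tree (\<lambda>c. of_bool (in_column_tree p n c)) (column_tree p n)"
      by (simp add: rep_tree_def is_tree_column_tree in_column_tree_iff)
    ultimately show ?thesis by auto
  qed
  moreover have "column_tree p n \<in> pdom (djump WWKL)"
    using m by (simp add: n_def cantor.emeasure_eq_measure)
  moreover have "\<exists>q' y'. computes ?H q q' \<and> outrep PC_natcantor q' y' \<and> y' \<in> prel PC_natcantor A"
    if q: "rep_cantor q y" and y: "y \<in> paths (column_tree p n)" for q y
  proof -
    have y': "\<And>i. i < n \<Longrightarrow> \<not> y i" "y n" "(n, \<lambda>i. y (Suc n + i)) \<in> A"
      using y paths_column_tree[OF p] by auto
    let ?q' = "\<lambda>s. if s = 0 then n else q (n + s)"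
    have s: "start (list_encode (map q [0..<k])) = min n k" for k
      unfolding start_def
    proof (rule Least_equality)
      let ?l = "list_encode (map q [0..<k])"
      show "min n k = code_length ?l \<or> code_nth ?l (min n k) \<noteq> 0"
        using y'(2) q by (auto simp: code_nth_prefix rep_cantor_def min_def)
      show "min n k \<le> i" if "i = code_length ?l \<or> code_nth ?l i \<noteq> 0" for i
        using that y'(1)[of i] q by (cases "i < n") (auto simp: code_nth_prefix rep_cantor_def split: if_splits)
    qed
    have "computes ?H q ?q'"
    proof (rule computesI)
      show "\<exists>k. ?P (query s q k)" for s
        by (intro exI[of _ "Suc (n + s)"]) (simp add: s del: upt_Suc)
      show "?P (query s q k) \<Longrightarrow> ?f (query s q k) = ?q' s" for s k
        by (auto simp: s code_nth_prefix min_def split: if_splits)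
    qed
    moreover have "rep_natcantor ?q' (n, \<lambda>i. y (Suc n + i))"
      using q by (simp add: rep_natcantor_def rep_cantor_def)
    ultimately show ?thesis using y'(3) by (auto simp: PC_natcantor_def)
  qed
  ultimately show "\<exists>p' x'. computes ?K p p' \<and> inrep (djump WWKL) p' x' \<and> x' \<in> pdom (djump WWKL) \<and>
      (\<forall>q y. outrep (djump WWKL) q y \<longrightarrow> y \<in> prel (djump WWKL) x' \<longrightarrow>
        (\<exists>q' y'. computes ?H q q' \<and> outrep PC_natcantor q' y' \<and> y' \<in> prel PC_natcantor A))"
    by (intro exI[of _ "?out p"] exI[of _ "column_tree p n"]) simp
qed

section \<open>Positive choice on the reals\<close>

lemma tc_bin_val [tc_intros]:
  assumes "total_computable n" "tcb (\<lambda>z. P (\<pi>1 z) (\<pi>2 z))"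
  shows "total_computable (\<lambda>x. bin_val (n x) (P x))"
proof -
  have P: "tcb (\<lambda>z. P (a z) (b z))" if "total_computable a" "total_computable b" for a b
    using tc_comp[OF assms(2) tc_basic2(3)[OF that]] by simp
  have "total_computable (\<lambda>x. rec_nat 0 (\<lambda>i r. 2 * r + of_bool (P x i)) (n x))"
    by (intro tc_intros P assms)
  moreover have "rec_nat 0 (\<lambda>i r. 2 * r + of_bool (Q i)) m = bin_val m Q" for m Q
    by (induction m) auto
  ultimately show ?thesis by simp
qed

lemma qnum_int [simp]: "qnum (prod_encode (n, 0)) = real_of_int (int_decode n)"
  by (simp add: qnum_def)

lemma ival_prod_encode [simp]: "ival (prod_encode (a, b)) = {qnum a<..<qnum b}"
  by (simp add: ival_def)

lemma ival_eq: "ival n = {qnum (\<pi>1 n)<..<qnum (\<pi>2 n)}"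
  by (simp add: ival_def case_prod_beta)

definition word_val :: "nat \<Rightarrow> nat" where
  "word_val c = bin_val (length (bl_of_nat c)) (word_bit c)"

lemma tc_word_val [tc_intros]:
  assumes "total_computable f"
  shows "total_computable (\<lambda>x. word_val (f x))"
  unfolding word_val_def by (intro tc_intros assms tc_comp[OF assms])

lemma mem_cyl_bl_of_nat_iff: "x \<in> cyl (bl_of_nat c) \<longleftrightarrow> bin_val (length (bl_of_nat c)) x = word_val c"
  unfolding word_val_def bin_val_eq_iff mem_cyl_iff word_bit_eq by blast

lemma bas_real_measurable: "bas_real n \<in> sets borel"
  by (simp add: bas_real_def ival_eq)

text \<open>A dyadic interval shorter than the distance of the point to both ends fits inside. Hence
  the preimage of an open rational interval is exhausted by cylinders recognized through comparisons
  of rationals.\<close>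

lemma cyl_in_open_interval:
  assumes "a < c + bin_real x" "c + bin_real x < b"
  shows "\<exists>w. x \<in> cyl (bl_of_nat w) \<and> a < c + word_val w * (1 / 2) ^ length (bl_of_nat w) \<and>
    c + (word_val w + 1) * (1 / 2) ^ length (bl_of_nat w) < b"
proof -
  obtain n where n: "(1 / 2 :: real) ^ n < min (c + bin_real x - a) (b - (c + bin_real x))"
    using real_arch_pow_inv[of "min (c + bin_real x - a) (b - (c + bin_real x))" "1 / 2"] assms by auto
  obtain w where w: "bl_of_nat w = map x [0..<n]" using bij_bl_of_nat by (metis bij_pointE)
  then have "x \<in> cyl (bl_of_nat w)" by (simp add: cyl_def)
  moreover from this have "word_val w = bin_val n x" "length (bl_of_nat w) = n"
    unfolding mem_cyl_bl_of_nat_iff by (simp_all add: w)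
  moreover have "a < c + bin_val n x * (1 / 2) ^ n" "c + (real (bin_val n x) + 1) * (1 / 2) ^ n < b"
    using n bin_real_bounds(1)[of n x] bin_real_bounds(2)[of x n] by (simp_all add: algebra_simps)
  ultimately show ?thesis by (intro exI[of _ w]) (simp add: add.commute)
qed

lemma PC_real_le_PC_natcantor: "sW_le PC_real PC_natcantor"
proof -
  let ?d = "\<lambda>b. (1 / 2 :: real) ^ length (bl_of_nat b)"
  \<comment> \<open>Read \<open>s\<close> as \<open>(j, (n, w))\<close>. Column \<open>n\<close>
    stands for the unit interval at \<open>int_decode n\<close>; cylinder \<open>w\<close> is
    removed there once its closed dyadic interval lies inside the interval listed by entry
    \<open>j\<close>. The pair \<open>(n, w)\<close> is already the code of the basic set.\<close>
  define out where "out P s = (if P (\<pi>1 s) \<noteq> 0 \<and>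
      qnum (\<pi>1 (P (\<pi>1 s) - 1)) < qnum (prod_encode (\<pi>1 (\<pi>2 s), 0)) + real (word_val (\<pi>2 (\<pi>2 s))) * ?d (\<pi>2 (\<pi>2 s)) \<and>
      qnum (prod_encode (\<pi>1 (\<pi>2 s), 0)) + real (Suc (word_val (\<pi>2 (\<pi>2 s)))) * ?d (\<pi>2 (\<pi>2 s)) < qnum (\<pi>2 (P (\<pi>1 s) - 1))
    then Suc (\<pi>2 s) else 0)" for P :: baire and s
  \<comment> \<open>Truncation after \<open>n\<close> bits errs by at most
    \<open>(1 / 2) ^ n\<close>, the precision that a Cauchy name demands.\<close>
  define approx where "approx P n = qnum (prod_encode (P 0, 0)) + real (bin_val n (\<lambda>i. P (Suc i) \<noteq> 0)) * (1 / 2) ^ n"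
    for P :: baire and n
  have "tcq (\<lambda>x. approx (code_nth (\<pi>2 x)) (\<pi>1 x))"
    unfolding approx_def by (intro tc_intros)
  from tcq_code[OF this] obtain c where c: "total_computable c" "\<And>x. qnum (c x) = approx (code_nth (\<pi>2 x)) (\<pi>1 x)"
    by blast
  \<comment> \<open>\<open>c\<close> may choose different codes of the same rational for different
    inputs. Cutting the prefix to a length fixed by the output position keeps the answer the same
    for all longer prefixes.\<close>
  let ?H = "\<lambda>x. of_bool (Suc (\<pi>1 x) \<le> code_length (\<pi>2 x)) *
    Suc (c (prod_encode (\<pi>1 x, code_take (Suc (\<pi>1 x)) (\<pi>2 x))))"
  let ?K = "\<lambda>x. of_bool (Suc (\<pi>1 (\<pi>1 x)) \<le> code_length (\<pi>2 x)) * Suc (out (code_nth (\<pi>2 x)) (\<pi>1 x))"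
  show ?thesis
  proof (rule sW_leI)
    show "total_computable ?H" by (intro tc_intros tc_comp[OF c(1)])
    show "total_computable ?K" unfolding out_def by (intro tc_intros)
    fix p A assume "inrep PC_real p A" and "A \<in> pdom PC_real"
    then have p: "rep_neg bas_real p A" and pos: "0 < emeasure lborel A"
      by (auto simp: PC_real_def)
    define B where "B = {(n, x). real_of_int (int_decode n) + bin_real x \<in> A}"
    have "computes ?K p (out p)"
      by (rule computes_finite_use[where f = "\<lambda>x. out (code_nth (\<pi>2 x)) (\<pi>1 x)" and u = "\<lambda>s. Suc (\<pi>1 s)"])
         (simp add: out_def code_nth_prefix)
    moreover have rep: "rep_neg bas_natcantor (out p) B"
    proof (rule rep_negI)
      fix z :: "nat \<times> (nat \<Rightarrow> bool)"
      obtain n x where z: "z = (n, x)" by force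
      let ?z = "real_of_int (int_decode n)"
      have "z \<notin> B \<longleftrightarrow> (\<exists>j. 0 < p j \<and> ?z + bin_real x \<in> ival (p j - 1))"
        unfolding z B_def using rep_neg_iff[OF p] by (simp add: bas_real_def)
      also have "\<dots> \<longleftrightarrow> (\<exists>s. 0 < out p s \<and> z \<in> bas_natcantor (out p s - 1))"
      proof
        assume "\<exists>j. 0 < p j \<and> ?z + bin_real x \<in> ival (p j - 1)"
        then obtain j where j: "0 < p j" "qnum (\<pi>1 (p j - 1)) < ?z + bin_real x" "?z + bin_real x < qnum (\<pi>2 (p j - 1))"
          by (auto simp: ival_eq)
        obtain w where "x \<in> cyl (bl_of_nat w)" "qnum (\<pi>1 (p j - 1)) < ?z + word_val w * ?d w"
          "?z + (word_val w + 1) * ?d w < qnum (\<pi>2 (p j - 1))"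
          using cyl_in_open_interval[OF j(2,3)] by blast
        then show "\<exists>s. 0 < out p s \<and> z \<in> bas_natcantor (out p s - 1)"
          using j(1) by (intro exI[of _ "prod_encode (j, prod_encode (n, w))"])
            (simp add: out_def z bas_natcantor_def add.commute)
      next
        assume "\<exists>s. 0 < out p s \<and> z \<in> bas_natcantor (out p s - 1)"
        then obtain s where s: "0 < out p s" "z \<in> bas_natcantor (out p s - 1)" by blast
        let ?j = "\<pi>1 s" and ?w = "\<pi>2 (\<pi>2 s)"
        have o: "out p s = Suc (\<pi>2 s)" "p ?j \<noteq> 0"
          "qnum (\<pi>1 (p ?j - 1)) < real_of_int (int_decode (\<pi>1 (\<pi>2 s))) + real (word_val ?w) * ?d ?w"
          "real_of_int (int_decode (\<pi>1 (\<pi>2 s))) + (real (word_val ?w) + 1) * ?d ?w < qnum (\<pi>2 (p ?j - 1))"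
          using s(1) by (auto simp: out_def add.commute split: if_splits)
        then have "n = \<pi>1 (\<pi>2 s)" and x: "bin_val (length (bl_of_nat ?w)) x = word_val ?w"
          using s(2) by (auto simp: z bas_natcantor_def case_prod_beta mem_cyl_bl_of_nat_iff)
        then have "?z + bin_real x \<in> ival (p ?j - 1)"
          using o(3,4) bin_real_bounds(1)[of "length (bl_of_nat ?w)" x] bin_real_bounds(2)[of x "length (bl_of_nat ?w)"]
          by (simp add: ival_eq x)
        then show "\<exists>j. 0 < p j \<and> ?z + bin_real x \<in> ival (p j - 1)" using o(2) by blast
      qed
      finally show "z \<notin> B \<longleftrightarrow> (\<exists>s. 0 < out p s \<and> z \<in> bas_natcantor (out p s - 1))" .
    qed
    moreover have "0 < emeasure natcantor_measure B"
    proof -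
      have A: "A \<in> sets borel" using rep_neg_measurable[OF p bas_real_measurable] by simp
      obtain z where z: "0 < emeasure lborel (A \<inter> {real_of_int z..real_of_int z + 1})"
        using emeasure_lborel_pos_unit_interval[OF A pos] by blast
      have "Pair (int_encode z) -` B = {x. real_of_int z + bin_real x \<in> A}" by (auto simp: B_def)
      then have "0 < emeasure cantor_measure (Pair (int_encode z) -` B)"
        using z emeasure_bin_real_shift[OF A] by simp
      moreover have "B \<in> sets natcantor_measure"
        using rep_neg_measurable[OF rep bas_natcantor_measurable space_natcantor] .
      ultimately show ?thesis using emeasure_natcantor_pos_iff by blast
    qed
    moreover have "\<exists>q' y'. computes ?H q q' \<and> rep_real q' y' \<and> y' \<in> A"
      if q: "rep_natcantor q z" and z: "z \<in> B" for q z
    proof -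
      obtain n x where nx: "z = (n, x)" by force
      let ?q' = "\<lambda>t. c (prod_encode (t, list_encode (map q [0..<Suc t])))"
      let ?y = "real_of_int (int_decode n) + bin_real x"
      have "computes ?H q ?q'"
        by (rule computes_finite_use[where f = "\<lambda>x. c (prod_encode (\<pi>1 x, code_take (Suc (\<pi>1 x)) (\<pi>2 x)))"])
           (simp add: code_take_prefix del: upt_Suc)
      moreover have "rep_real ?q' ?y"
        unfolding rep_real_def
      proof
        fix t
        have "bin_val t (\<lambda>i. code_nth (list_encode (map q [0..<Suc t])) (Suc i) \<noteq> 0) = bin_val t x"
          using q by (intro bin_val_cong) (simp add: code_nth_prefix rep_natcantor_def nx del: upt_Suc)
        then have "qnum (?q' t) = real_of_int (int_decode n) + bin_val t x * (1 / 2) ^ t"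
          using q by (simp add: c(2) approx_def code_nth_prefix rep_natcantor_def nx del: upt_Suc)
        then show "\<bar>qnum (?q' t) - ?y\<bar> \<le> (1 / 2) ^ t"
          using bin_real_bounds(1)[of t x] bin_real_bounds(2)[of x t] by (simp add: algebra_simps)
      qed
      moreover have "?y \<in> A" using z by (simp add: B_def nx)
      ultimately show ?thesis by blast
    qed
    ultimately show "\<exists>p' x'. computes ?K p p' \<and> inrep PC_natcantor p' x' \<and> x' \<in> pdom PC_natcantor \<and>
        (\<forall>q y. outrep PC_natcantor q y \<longrightarrow> y \<in> prel PC_natcantor x' \<longrightarrow>
          (\<exists>q' y'. computes ?H q q' \<and> outrep PC_real q' y' \<and> y' \<in> prel PC_real A))"
      unfolding PC_real_def PC_natcantor_def PC_simps by blast
  qed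
qed

section \<open>Reading binary digits off an irrational number\<close>

text \<open>Doubling a number doubles its integer part or doubles it and adds one, so the parity of
  the integer part of \<open>y * 2 ^ Suc i\<close> is the binary digit \<open>i\<close> after the
  point.\<close>

lemma nat_floor_bin_val:
  fixes y :: real
  assumes "0 \<le> y"
  shows "nat \<lfloor>y * 2 ^ n\<rfloor> = nat \<lfloor>y\<rfloor> * 2 ^ n + bin_val n (\<lambda>i. odd (nat \<lfloor>y * 2 ^ Suc i\<rfloor>))"
proof (induction n)
  case (Suc n)
  let ?a = "nat \<lfloor>y * 2 ^ n\<rfloor>" and ?b = "nat \<lfloor>y * 2 ^ Suc n\<rfloor>"
  have "real ?a \<le> y * 2 ^ n" "y * 2 ^ n < real ?a + 1" "real ?b \<le> y * 2 ^ Suc n" "y * 2 ^ Suc n < real ?b + 1"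
    using assms by auto
  moreover have "y * 2 ^ Suc n = 2 * (y * 2 ^ n)" by simp
  ultimately have "2 * real ?a < real ?b + 1" "real ?b < 2 * real ?a + 2" by linarith+
  then have "?b = 2 * ?a \<or> ?b = 2 * ?a + 1" by linarith
  then have "?b = 2 * ?a + of_bool (odd ?b)" by auto
  then show ?case using Suc by (simp add: algebra_simps)
qed simp

text \<open>Equality would make \<open>y\<close> the dyadic rational \<open>k / 2 ^ n\<close>.
  Strictness leaves a gap on both sides, which a Cauchy name detects after finitely many
  entries.\<close>

lemma real_dyadic_bounds:
  fixes y :: real
  assumes "0 \<le> y" "\<And>t. y \<noteq> qnum t"
  shows "real (nat \<lfloor>y * 2 ^ n\<rfloor>) * (1 / 2) ^ n < y" "y < (real (nat \<lfloor>y * 2 ^ n\<rfloor>) + 1) * (1 / 2) ^ n"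
proof -
  have "real k \<noteq> y * 2 ^ n" for k
  proof
    assume "real k = y * 2 ^ n"
    then have "y = qnum (prod_encode (int_encode (int k), 2 ^ n - 1))"
      by (simp add: qnum_def field_simps of_nat_diff)
    then show False using assms(2) by blast
  qed
  then have ne: "real (nat \<lfloor>y * 2 ^ n\<rfloor>) \<noteq> y * 2 ^ n" .
  have le: "real (nat \<lfloor>y * 2 ^ n\<rfloor>) \<le> y * 2 ^ n" and less: "y * 2 ^ n < real (nat \<lfloor>y * 2 ^ n\<rfloor>) + 1"
    using assms(1) by auto
  have scale: "real k * (1 / 2) ^ n < y \<longleftrightarrow> real k < y * 2 ^ n"
    "y < (real k + 1) * (1 / 2) ^ n \<longleftrightarrow> y * 2 ^ n < real k + 1" for k
    by (simp_all add: field_simps power_divide)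
  show "real (nat \<lfloor>y * 2 ^ n\<rfloor>) * (1 / 2) ^ n < y" "y < (real (nat \<lfloor>y * 2 ^ n\<rfloor>) + 1) * (1 / 2) ^ n"
    unfolding scale by (rule order.not_eq_order_implies_strict[OF ne le], rule less)
qed

text \<open>The lengths \<open>(1 / 2) ^ e\<close> add up to 2. As this exceeds 1, a single copy of
  a column could be removed entirely, and many copies are needed.\<close>

definition rational_nbhd :: "nat \<Rightarrow> real set" where
  "rational_nbhd e = {qnum e - (1 / 2) ^ Suc e<..<qnum e + (1 / 2) ^ Suc e}"

lemma rational_nbhds_measure: "emeasure lborel (\<Union>e. rational_nbhd e) < \<infinity>"
proof -
  have "emeasure lborel (rational_nbhd e) = ennreal ((1 / 2) ^ e)" for e
    by (simp add: rational_nbhd_def)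
  moreover have "emeasure lborel (\<Union>e. rational_nbhd e) \<le> (\<Sum>e. emeasure lborel (rational_nbhd e))"
    by (rule emeasure_subadditive_countably) (auto simp: rational_nbhd_def)
  moreover have "(\<Sum>e. ennreal ((1 / 2) ^ e)) = ennreal (\<Sum>e. (1 / 2) ^ e)"
    by (rule suminf_ennreal2) (auto intro: summable_geometric)
  ultimately show ?thesis by (simp add: le_less_trans)
qed

lemma PC_natcantor_le_PC_real: "sW_le PC_natcantor PC_real"
proof -
  let ?d = "\<lambda>b. (1 / 2 :: real) ^ length (bl_of_nat b)"
  \<comment> \<open>Read \<open>e\<close> as \<open>(t, v)\<close>: entry \<open>t\<close> of the
    name certifies that \<open>y * 2 ^ s\<close> lies strictly between \<open>v\<close> and
    \<open>v + 1\<close>, so \<open>v\<close> is its integer part.\<close>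
  define good where "good P s e \<longleftrightarrow> real (\<pi>2 e) < (qnum (P (\<pi>1 e)) - (1 / 2) ^ \<pi>1 e) * 2 ^ s \<and>
      (qnum (P (\<pi>1 e)) + (1 / 2) ^ \<pi>1 e) * 2 ^ s < real (Suc (\<pi>2 e))" for P :: baire and s e
  \<comment> \<open>For \<open>s = 0\<close> the integer part of \<open>y\<close> is the place of a
    copy, and \<open>\<pi>1\<close> gives its column; for \<open>s > 0\<close> the parity is the
    next binary digit.\<close>
  define dec where "dec s v = (if s = 0 then \<pi>1 v else v mod 2)" for s v :: nat
  let ?P = "\<lambda>x. \<exists>e<code_length (\<pi>2 x). good (code_nth (\<pi>2 x)) (\<pi>1 x) e"
  \<comment> \<open>Longer prefixes may find a different certificate \<open>e\<close>, but all
    certificates contain the same integer part.\<close>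
  let ?f = "\<lambda>x. dec (\<pi>1 x) (\<pi>2 (LEAST e. e = code_length (\<pi>2 x) \<or> good (code_nth (\<pi>2 x)) (\<pi>1 x) e))"
  let ?H = "\<lambda>x. of_bool (?P x) * Suc (?f x)"
  have "tcq (\<lambda>s. qnum (\<pi>2 s) - (1 / 2) ^ Suc (\<pi>2 s))" by (intro tc_intros)
  from tcq_code[OF this] obtain a0 where a0: "total_computable a0" "\<And>s. qnum (a0 s) = qnum (\<pi>2 s) - (1 / 2) ^ Suc (\<pi>2 s)" by blast
  have "tcq (\<lambda>s. qnum (\<pi>2 s) + (1 / 2) ^ Suc (\<pi>2 s))" by (intro tc_intros)
  from tcq_code[OF this] obtain b0 where b0: "total_computable b0" "\<And>s. qnum (b0 s) = qnum (\<pi>2 s) + (1 / 2) ^ Suc (\<pi>2 s)" by blast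
  have "tcq (\<lambda>s. 0 - real (Suc (\<pi>2 s)))" by (intro tc_intros)
  from tcq_code[OF this] obtain a1 where a1: "total_computable a1" "\<And>s. qnum (a1 s) = 0 - real (Suc (\<pi>2 s))" by blast
  have "tcq (\<lambda>s. real (\<pi>1 s) + real (word_val (\<pi>2 s)) * ?d (\<pi>2 s))" by (intro tc_intros)
  from tcq_code[OF this] obtain a2 where a2: "total_computable a2" "\<And>s. qnum (a2 s) = real (\<pi>1 s) + real (word_val (\<pi>2 s)) * ?d (\<pi>2 s)" by blast
  have "tcq (\<lambda>s. real (\<pi>1 s) + real (Suc (word_val (\<pi>2 s))) * ?d (\<pi>2 s))" by (intro tc_intros)
  from tcq_code[OF this] obtain b2 where b2: "total_computable b2" "\<And>s. qnum (b2 s) = real (\<pi>1 s) + real (Suc (word_val (\<pi>2 s))) * ?d (\<pi>2 s)" by blast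
  \<comment> \<open>If \<open>r - 1\<close> codes column \<open>n\<close> and word \<open>w\<close>,
    this is the word \<open>w\<close> in copy \<open>e\<close> of the column, located at the integer
    \<open>prod_encode (n, e)\<close>.\<close>
  define col where "col r e = prod_encode (prod_encode (\<pi>1 (r - 1), e), \<pi>2 (r - 1))" for r e
  \<comment> \<open>The first component of \<open>s\<close> selects the task: 0 removes
    neighbourhoods of rationals, 1 removes the negative half-line piece by piece, and
    \<open>j + 2\<close> transfers entry \<open>j\<close> of the name to every copy of its
    column.\<close>
  define out where "out P s =
     (if \<pi>1 s = 0 then Suc (prod_encode (a0 s, b0 s))
      else if \<pi>1 s = 1 then Suc (prod_encode (a1 s, prod_encode (0, 0)))
      else if P (\<pi>1 s - 2) = 0 then 0
      else Suc (prod_encode (a2 (col (P (\<pi>1 s - 2)) (\<pi>2 s)), b2 (col (P (\<pi>1 s - 2)) (\<pi>2 s)))))" for P :: baire and s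
  let ?K = "\<lambda>x. of_bool (\<pi>1 (\<pi>1 x) \<le> code_length (\<pi>2 x)) * Suc (out (code_nth (\<pi>2 x)) (\<pi>1 x))"
  show ?thesis
  proof (rule sW_leI)
    show "total_computable ?H" unfolding good_def dec_def by (intro tc_intros)
    show "total_computable ?K"
      unfolding out_def col_def
      by (intro tc_intros tc_comp[OF a0(1)] tc_comp[OF b0(1)] tc_comp[OF a1(1)] tc_comp[OF a2(1)] tc_comp[OF b2(1)])
    fix p A assume "inrep PC_natcantor p A" and "A \<in> pdom PC_natcantor"
    then have p: "rep_neg bas_natcantor p A" and pos: "0 < emeasure natcantor_measure A"
      by (auto simp: PC_natcantor_def)
    let ?n = "\<lambda>j. \<pi>1 (p j - 1)" and ?w = "\<lambda>j. \<pi>2 (p j - 1)"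
    let ?I = "\<lambda>j e. {real (prod_encode (?n j, e)) + real (word_val (?w j)) * ?d (?w j) <..<
        real (prod_encode (?n j, e)) + (real (word_val (?w j)) + 1) * ?d (?w j)}"
    \<comment> \<open>Only the interiors of dyadic intervals are removed by \<open>?I\<close>; their
      endpoints are rational and disappear with the neighbourhoods.\<close>
    define B where "B = - ((\<Union>e. rational_nbhd e) \<union> (\<Union>e. {- real (Suc e)<..<0}) \<union> (\<Union>j\<in>{j. p j \<noteq> 0}. \<Union>e. ?I j e))"
    have A_iff: "(n, x) \<notin> A \<longleftrightarrow> (\<exists>j. p j \<noteq> 0 \<and> ?n j = n \<and> bin_val (length (bl_of_nat (?w j))) x = word_val (?w j))" for n x
      unfolding rep_neg_iff[OF p] bas_natcantor_def by (auto simp: case_prod_beta mem_cyl_bl_of_nat_iff)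
    have "computes ?K p (out p)"
      by (rule computes_finite_use[where f = "\<lambda>x. out (code_nth (\<pi>2 x)) (\<pi>1 x)" and u = \<pi>1])
         (auto simp: out_def code_nth_prefix)
    moreover have rep: "rep_neg bas_real (out p) B"
    proof (rule rep_negI)
      fix y :: real
      have out: "bas_real (out p (prod_encode (0, e)) - 1) = rational_nbhd e"
        "bas_real (out p (prod_encode (Suc 0, e)) - 1) = {- real (Suc e)<..<0}"
        "p j \<noteq> 0 \<Longrightarrow> bas_real (out p (prod_encode (Suc (Suc j), e)) - 1) = ?I j e" for e j
        by (simp_all add: out_def bas_real_def a0(2) b0(2) a1(2) a2(2) b2(2) rational_nbhd_def col_def
            qnum_def[of "prod_encode (0, 0)"] int_decode_def sum_decode_def add.commute)
      have outpos: "0 < out p (prod_encode (0, e))" "0 < out p (prod_encode (Suc 0, e))"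
        "0 < out p (prod_encode (Suc (Suc j), e)) \<longleftrightarrow> p j \<noteq> 0" for e j
        by (simp_all add: out_def)
      have "(\<exists>s. 0 < out p s \<and> y \<in> bas_real (out p s - 1)) \<longleftrightarrow>
          (\<exists>c e. 0 < out p (prod_encode (c, e)) \<and> y \<in> bas_real (out p (prod_encode (c, e)) - 1))"
        by (metis prod_decode_inverse surj_pair)
      also have "\<dots> \<longleftrightarrow> (\<exists>e. y \<in> rational_nbhd e) \<or> (\<exists>e. y \<in> {- real (Suc e)<..<0}) \<or> (\<exists>j e. p j \<noteq> 0 \<and> y \<in> ?I j e)"
        (is "(\<exists>c e. ?Q c e) \<longleftrightarrow> ?R")
      proof
        assume "\<exists>c e. ?Q c e"
        then obtain c e where ce: "?Q c e" by blast
        consider "c = 0" | "c = Suc 0" | j where "c = Suc (Suc j)" by (metis not0_implies_Suc)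
        then show ?R
        proof cases
          case (3 j)
          then have "p j \<noteq> 0" using ce outpos by blast
          then show ?thesis using ce out(3) 3 by blast
        qed (use ce out in blast)+
      next
        assume ?R
        then show "\<exists>c e. ?Q c e" using out outpos by blast
      qed
      also have "\<dots> \<longleftrightarrow> y \<notin> B" unfolding B_def by blast
      finally show "y \<notin> B \<longleftrightarrow> (\<exists>s. 0 < out p s \<and> y \<in> bas_real (out p s - 1))" by blast
    qed
    moreover have irrational: "y \<noteq> qnum t" if "y \<in> B" for y t
    proof
      assume "y = qnum t"
      then have "y \<in> rational_nbhd t" by (simp add: rational_nbhd_def)
      then show False using that unfolding B_def by blast
    qed
    moreover have nonneg: "0 \<le> y" if "y \<in> B" for y
    proof (rule ccontr)
      assume "\<not> 0 \<le> y"
      moreover obtain e where "- y < real e" using reals_Archimedean2 by blast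
      ultimately have "y \<in> {- real (Suc e)<..<0}" by simp
      then show False using that unfolding B_def by blast
    qed
    moreover have "0 < emeasure lborel B"
    proof -
      have A: "A \<in> sets natcantor_measure"
        using rep_neg_measurable[OF p bas_natcantor_measurable space_natcantor] .
      have B: "B \<in> sets borel" using rep_neg_measurable[OF rep bas_real_measurable] by simp
      obtain n where n: "0 < emeasure cantor_measure (Pair n -` A)"
        using pos emeasure_natcantor_pos_iff[OF A] by blast
      let ?U = "\<Union>e. rational_nbhd e"
      have U: "?U \<in> sets borel" by (auto simp: rational_nbhd_def)
      have "inj (\<lambda>k. prod_encode (n, k))" by (simp add: inj_on_def)
      from emeasure_finite_tail[OF U rational_nbhds_measure n this]
      obtain k where k: "emeasure lborel (?U \<inter> {real (prod_encode (n, k))..real (prod_encode (n, k)) + 1})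
          < emeasure cantor_measure (Pair n -` A)" by blast
      define m where "m = prod_encode (n, k)"
      let ?pre = "\<lambda>S. {x. real m + bin_real x \<in> S}"
      have pre: "?pre S \<in> sets cantor_measure" if "S \<in> sets borel" for S
      proof -
        have "(\<lambda>x. real m + bin_real x) \<in> borel_measurable cantor_measure" by measurable
        from measurable_sets[OF this that] show ?thesis by (simp add: vimage_def)
      qed
      \<comment> \<open>A point of column \<open>n\<close>, placed in the chosen copy, stays in
        \<open>B\<close> unless it falls into a neighbourhood of a rational. These take less than
        the measure of the column from this copy, so by subadditivity \<open>B\<close> keeps a
        positive part.\<close>
      have sub: "Pair n -` A \<subseteq> ?pre B \<union> ?pre ?U"
      proof
        fix x assume "x \<in> Pair n -` A"
        then have x: "(n, x) \<in> A" by simp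
        let ?y = "real m + bin_real x"
        have "?y \<in> B" if U': "?y \<notin> ?U"
        proof -
          have "?y \<notin> {- real (Suc e)<..<0}" for e
            using bin_real_range(1)[of x] by auto
          moreover have "?y \<notin> ?I j e" if j: "p j \<noteq> 0" for j e
          proof
            assume y: "?y \<in> ?I j e"
            let ?m' = "prod_encode (?n j, e)" and ?l = "length (bl_of_nat (?w j))"
            have "word_val (?w j) < 2 ^ ?l" unfolding word_val_def by (rule bin_val_less)
            then have "real (word_val (?w j) + 1) \<le> real (2 ^ ?l)" by (simp only: of_nat_le_iff)
            then have "(real (word_val (?w j)) + 1) * ?d (?w j) \<le> 1" by (simp add: field_simps power_divide)
            moreover have "0 \<le> real (word_val (?w j)) * ?d (?w j)" by simp
            moreover note yb = y[unfolded greaterThanLessThan_iff]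
            ultimately have "real ?m' < ?y" "?y < real ?m' + 1" by linarith+
            \<comment> \<open>The all-ones expansion reaches the right end of the closed unit
              interval, which also belongs to the next one. This point is an integer and so lies in
              a neighbourhood of a rational; excluding it identifies the copy uniquely.\<close>
            moreover have "?y \<noteq> real m + 1"
            proof
              assume "?y = real m + 1"
              then have "?y = qnum (prod_encode (int_encode (int m + 1), 0))" by simp
              then have "?y \<in> rational_nbhd (prod_encode (int_encode (int m + 1), 0))"
                by (simp add: rational_nbhd_def)
              then show False using U' by blast
            qed
            ultimately have "real ?m' < real m + 1" "real m < real ?m' + 1"
              using bin_real_range[of x] by linarith+
            then have mm: "?m' = m" by linarith
            then have "?n j = n" by (simp add: m_def)
            have b: "real (word_val (?w j)) * ?d (?w j) < bin_real x" "bin_real x < (real (word_val (?w j)) + 1) * ?d (?w j)"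
              using yb unfolding mm by auto
            have "real (word_val (?w j)) * ?d (?w j) < (real (bin_val ?l x) + 1) * ?d (?w j)"
              "real (bin_val ?l x) * ?d (?w j) < (real (word_val (?w j)) + 1) * ?d (?w j)"
              using b bin_real_bounds(1)[of ?l x] bin_real_bounds(2)[of x ?l] by linarith+
            then have "real (word_val (?w j)) < real (bin_val ?l x) + 1" "real (bin_val ?l x) < real (word_val (?w j)) + 1"
              by (simp_all add: mult_less_cancel_right_pos)
            then have "bin_val ?l x = word_val (?w j)" by linarith
            then show False using A_iff x j \<open>?n j = n\<close> by blast
          qed
          ultimately show ?thesis using U' unfolding B_def by blast
        qed
        then show "x \<in> ?pre B \<union> ?pre ?U" by blast
      qed
      have "emeasure cantor_measure (Pair n -` A) \<le> emeasure cantor_measure (?pre B \<union> ?pre ?U)"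
        by (intro emeasure_mono sub sets.Un pre[OF B] pre[OF U])
      also have "\<dots> \<le> emeasure cantor_measure (?pre B) + emeasure cantor_measure (?pre ?U)"
        by (intro emeasure_subadditive pre[OF B] pre[OF U])
      finally have "emeasure cantor_measure (Pair n -` A) \<le>
          emeasure cantor_measure (?pre B) + emeasure cantor_measure (?pre ?U)" .
      moreover have "emeasure cantor_measure (?pre ?U) < emeasure cantor_measure (Pair n -` A)"
        using k unfolding m_def emeasure_bin_real_shift[OF U] .
      ultimately have "emeasure cantor_measure (?pre B) \<noteq> 0" by (auto simp: not_le[symmetric])
      then have "0 < emeasure lborel (B \<inter> {real m..real m + 1})"
        unfolding emeasure_bin_real_shift[OF B] by (simp add: zero_less_iff_neq_zero)
      also have "\<dots> \<le> emeasure lborel B" using B by (intro emeasure_mono) auto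
      finally show ?thesis .
    qed
    moreover have "\<exists>q' z. computes ?H q q' \<and> rep_natcantor q' z \<and> z \<in> A"
      if q: "rep_real q y" and y: "y \<in> B" for q y
    proof -
      define N where "N s = nat \<lfloor>y * 2 ^ s\<rfloor>" for s
      define x where "x i = odd (N (Suc i))" for i
      let ?q' = "\<lambda>s. dec s (N s)"
      note bounds = real_dyadic_bounds[OF nonneg[OF y] irrational[OF y], folded N_def]
      have q': "qnum (q t) - (1 / 2) ^ t \<le> y" "y \<le> qnum (q t) + (1 / 2) ^ t" for t
        using q[unfolded rep_real_def, rule_format, of t] by linarith+
      have sound: "\<pi>2 e = N s" if "good q s e" for s e
      proof -
        let ?r = "qnum (q (\<pi>1 e))" and ?h = "(1 / 2 :: real) ^ \<pi>1 e"
        have "(?r - ?h) * 2 ^ s \<le> y * 2 ^ s" "y * 2 ^ s \<le> (?r + ?h) * 2 ^ s"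
          using q'[of "\<pi>1 e"] by (auto intro: mult_right_mono)
        then have "real (\<pi>2 e) < y * 2 ^ s" "y * 2 ^ s < real (\<pi>2 e) + 1"
          using that unfolding good_def by linarith+
        then have "\<lfloor>y * 2 ^ s\<rfloor> = int (\<pi>2 e)" by (intro floor_unique) auto
        then show ?thesis by (simp add: N_def)
      qed
      have complete: "\<exists>e. good q s e" for s
      proof -
        \<comment> \<open>The distance of \<open>y * 2 ^ s\<close> to the two neighbouring integers.
          Entry \<open>t\<close> errs by \<open>(1 / 2) ^ t\<close>, and \<open>good\<close> demands
          the same margin once more; this explains the factor 2.\<close>
        let ?g = "min (y * 2 ^ s - N s) (N s + 1 - y * 2 ^ s)"
        have "0 < ?g" using bounds[of s] by (simp add: field_simps power_divide)
        then obtain t where "(1 / 2 :: real) ^ t < ?g / (2 * 2 ^ s)"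
          using real_arch_pow_inv[of "?g / (2 * 2 ^ s)" "1 / 2"] by auto
        then have t: "2 * (1 / 2) ^ t * 2 ^ s < ?g" by (simp add: field_simps)
        have "(y - 2 * (1 / 2) ^ t) * 2 ^ s \<le> (qnum (q t) - (1 / 2) ^ t) * 2 ^ s"
          "(qnum (q t) + (1 / 2) ^ t) * 2 ^ s \<le> (y + 2 * (1 / 2) ^ t) * 2 ^ s"
          using q'[of t] by (auto intro!: mult_right_mono)
        then have "good q s (prod_encode (t, N s))"
          using t unfolding good_def by (simp add: algebra_simps)
        then show ?thesis by blast
      qed
      \<comment> \<open>Since \<open>\<pi>1 e \<le> e < k\<close>, the test consults an entry really
        present in the prefix, not the default 0 of \<open>code_nth\<close>.\<close>
      have good_prefix: "good (code_nth (list_encode (map q [0..<k]))) s e \<longleftrightarrow> good q s e" if "e < k" for k s e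
      proof -
        have "\<pi>1 e < k" using that le_prod_encode_1[of "\<pi>1 e" "\<pi>2 e"] by simp
        then show ?thesis by (simp add: good_def code_nth_prefix)
      qed
      have "computes ?H q ?q'"
      proof (rule computesI)
        fix s
        obtain e where "good q s e" using complete by blast
        then show "\<exists>k. ?P (query s q k)"
          using good_prefix[of e "Suc e" s]
          by (intro exI[of _ "Suc e"] exI[of _ e]) (simp del: upt_Suc)
        show "?f (query s q k) = ?q' s" if Pk: "?P (query s q k)" for k
        proof -
          let ?G = "\<lambda>e. e = k \<or> good (code_nth (list_encode (map q [0..<k]))) s e"
          obtain e where e: "e < k" "good (code_nth (list_encode (map q [0..<k]))) s e"
            using Pk by auto
          have "?G (Least ?G)" by (rule LeastI[of ?G k]) simp
          moreover have "Least ?G \<le> e" by (rule Least_le) (use e in simp)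
          ultimately have "good q s (Least ?G)" using e(1) good_prefix[of "Least ?G" k s] by auto
          then show ?thesis using sound by simp
        qed
      qed
      moreover have "rep_natcantor ?q' (\<pi>1 (N 0), x)"
        by (auto simp: rep_natcantor_def dec_def x_def odd_iff_mod_2_eq_one)
      moreover have "(\<pi>1 (N 0), x) \<in> A"
      proof (rule ccontr)
        assume "(\<pi>1 (N 0), x) \<notin> A"
        then obtain j where j: "p j \<noteq> 0" "?n j = \<pi>1 (N 0)" "bin_val (length (bl_of_nat (?w j))) x = word_val (?w j)"
          unfolding A_iff by blast
        let ?l = "length (bl_of_nat (?w j))"
        have "N ?l = N 0 * 2 ^ ?l + word_val (?w j)"
          using nat_floor_bin_val[OF nonneg[OF y], of ?l] j(3) by (simp add: N_def x_def[abs_def])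
        \<comment> \<open>\<open>N 0\<close> is the place of copy \<open>\<pi>2 (N 0)\<close> of the
          column of entry \<open>j\<close>, and the strict bounds at level \<open>?l\<close> put
          \<open>y\<close> inside the open dyadic interval removed there.\<close>
        then have "y \<in> ?I j (\<pi>2 (N 0))"
          using bounds[of ?l] j(2) by (simp add: algebra_simps power_divide add_divide_distrib)
        then show False using y j(1) unfolding B_def by blast
      qed
      ultimately show ?thesis by blast
    qed
    ultimately show "\<exists>p' x'. computes ?K p p' \<and> inrep PC_real p' x' \<and> x' \<in> pdom PC_real \<and>
        (\<forall>q y. outrep PC_real q y \<longrightarrow> y \<in> prel PC_real x' \<longrightarrow>
          (\<exists>q' y'. computes ?H q q' \<and> outrep PC_natcantor q' y' \<and> y' \<in> prel PC_natcantor A))"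
      unfolding PC_real_def PC_natcantor_def PC_simps by blast
  qed
qed

theorem theorem9p3:
  shows "sW_equiv (djump WWKL) (djump PC_cantor)
       \<and> sW_equiv (djump PC_cantor) PC_real
       \<and> sW_equiv PC_real PC_natcantor"
  unfolding sW_equiv_def
  using WWKL_le_PC_cantor PC_cantor_le_PC_natcantor PC_natcantor_le_WWKL
    PC_real_le_PC_natcantor PC_natcantor_le_PC_real
  by (blast intro: sW_le_trans)

end
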